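(* Let $S:X\rightrightarrows Y$ be a set-valued mapping between Banach spaces, and let $\Omega\subset X$ and $\Theta\subset Y$ be closed. Pick $(\bar x,\bar y)\in\operatorname{gph}S|_\Omega^\Theta$ and suppose that $\operatorname{gph}S|_\Omega^\Theta$ is closed around $(\bar x,\bar y)$. Then the following properties (a), (b), (c) are equivalent: (a) The inverse $S^{-1}$ is Lipschitz-like relative to $\Theta\times\Omega$ around $(\bar y,\bar x)$. (b) $S$ is metrically regular relative to $\Omega\times\Theta$ around $(\bar x,\bar y)$, i.e., there exist $V\in\mathcal N(\bar x)$, $W\in\mathcal N(\bar y)$, and $\kappa\ge0$ such that $$d\big(x',S^{-1}|^\Omega(y)\big)\le\kappa\, d\big(y,S|^\Theta(x')\big)\quad\text{for all }x'\in\Omega\cap V,\ y\in\Theta\cap W.$$ (c) $S$ is linearly open relative to $\Omega\times\Theta$ around $(\bar x,\bar y)$, i.e., there exist $V\in\mathcal N(\bar x)$, $W\in\mathcal N(\bar y)$, and $\kappa\ge0$ such that $$\big(S|^\Theta(x')+\varepsilon B_Y\big)\cap\Theta\cap W\subset S|_\Omega(x'+\kappa\varepsilon B_X)\quad\text{for all }x'\in\Omega\cap V,\ \varepsilon>0.$$ If moreover $X$ and $Y$ are reflexive and $\Omega$ and $\Theta$ are convex, then (a), (b), (c) are also equivalent to the relative mirror contingent coderivative criterion: (d) $S$ is mirror PSNC relative to $\Omega\times\Theta$ at $(\bar x,\bar y)$ and $\ker D_m^*S_\Omega^\Theta(\bar x|\bar y)=\{0\}$.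
   Context: Conventions. "Reflexive Banach space" means a reflexive Banach space normed in such a way that both $X$ and $X^*$ are locally uniformly convex. $B_X$ is the closed unit ball; $\rightharpoonup^*$ is weak$^*$ convergence; $X\times Y$ carries the norm $\sqrt{\|x\|^2+\|y\|^2}$. $\mathcal N(\bar x)$ is the collection of open neighborhoods of $\bar x$. $d(x,A)=\inf_{z\in A}\|z-x\|$, with $d(x,\emptyset)=\infty$. A set is closed around one of its points $\bar u$ if its intersection with some closed set containing $\bar u$ in its interior is closed. $\operatorname{gph}S=\{(x,y): y\in S(x)\}$; $S|_\Omega^\Theta(x)=S(x)\cap\Theta$ if $x\in\Omega$ and $\emptyset$ otherwise, so $\operatorname{gph}S|_\Omega^\Theta=\operatorname{gph}S\cap(\Omega\times\Theta)$; $S|^\Theta(x)=S(x)\cap\Theta$; $S|_\Omega(x)=S(x)$ if $x\in\Omega$ and $\emptyset$ otherwise; $S|_\Omega(A)=\bigcup_{x\in A\cap\Omega}S(x)$; $S^{-1}|^\Omega(y)=S^{-1}(y)\cap\Omega$. $\ker H=\{u: 0\in H(u)\}$. Relative Lipschitz-like property: a mapping $F:U\rightrightarrows Z$ is Lipschitz-like relative to $A\times C$ around $(\bar u,\bar z)\in\operatorname{gph}F|_A^C$ if $\operatorname{gph}F|_A^C$ is closed around this point and there are neighborhoods $V$ of $\bar u$, $W$ of $\bar z$ and $\kappa\ge0$ with $F(u')\cap C\cap W\subset F(u)\cap C+\kappa\|u'-u\|B_Z$ for all $u,u'\in A\cap V$. Duality mapping: $J_X(x)=\{x^*\in X^*: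 \langle x^*,x\rangle=\|x\|^2,\ \|x^*\|=\|x\|\}$; for a set $A$, $J_X(A)=\bigcup_{x\in A}J_X(x)$. Contingent cone at $\bar x\in\Omega$: $T(\bar x;\Omega)=\{z: \exists\, t_k\downarrow0,\ z_k\to z,\ \bar x+t_kz_k\in\Omega\}$. $\varepsilon$-normals at $\bar x\in\Omega$: $\widehat N_\varepsilon(\bar x;\Omega)=\{x^*: \limsup_{x\to\bar x,\,x\in\Omega}\langle x^*,x-\bar x\rangle/\|x-\bar x\|\le\varepsilon\}$. Mirror contingent coderivative: $\bar x^*\in D_m^*S_\Omega^\Theta(\bar x|\bar y)(\bar y^* )$ iff there are $\varepsilon_k\downarrow0$, $(x_k,y_k)\to(\bar x,\bar y)$ with $(x_k,y_k)\in\operatorname{gph}S|_\Omega^\Theta$, $y_k^*\rightharpoonup^*\bar y^*$, and $x_k^*\to\bar x^*$ (in norm) such that for all $k$ $$(x_k^*,-y_k^* )\in\widehat N_{\varepsilon_k}\big((x_k,y_k);\operatorname{gph}S|_\Omega^\Theta\big)\cap\big[J_X(T(x_k;\Omega))\times J_Y(T(y_k;\Theta))\big].\qquad( * )$$ Mirror PSNC: $S$ is mirror PSNC relative to $\Omega\times\Theta$ at $(\bar x,\bar y)$ if for all sequences $\varepsilon_k\in(0,1)$, $(x_k,y_k)\in\operatorname{gph}S|_\Omega^\Theta$, $(x_k^*,y_k^* )$ satisfying $( * )$ with $\varepsilon_k\downarrow0$, $(x_k,y_k)\to(\bar x,\bar y)$, $x_k^*\to0$, $y_k^*\rightharpoonup^*0$,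 one has $\|y_k^*\|\to0$. *)

theory Defs
  imports "HOL-Analysis.Analysis"
begin

definition gph :: "('a \<Rightarrow> 'b set) \<Rightarrow> ('a \<times> 'b) set" where
  "gph F = {(x, y). y \<in> F x}"

definition setmap_inv :: "('a \<Rightarrow> 'b set) \<Rightarrow> 'b \<Rightarrow> 'a set" where
  "setmap_inv F y = {x. y \<in> F x}"

definition restr_dom :: "('a \<Rightarrow> 'b set) \<Rightarrow> 'a set \<Rightarrow> 'a \<Rightarrow> 'b set" where
  "restr_dom F A x = (if x \<in> A then F x else {})"

definition restr_ran :: "('a \<Rightarrow> 'b set) \<Rightarrow> 'b set \<Rightarrow> 'a \<Rightarrow> 'b set" where
  "restr_ran F C x = F x \<inter> C"

definition restr :: "('a \<Rightarrow> 'b set) \<Rightarrow> 'a set \<Rightarrow> 'b set \<Rightarrow> 'a \<Rightarrow> 'b set" where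
  "restr F A C x = (if x \<in> A then F x \<inter> C else {})"

definition setmap_image :: "('a \<Rightarrow> 'b set) \<Rightarrow> 'a set \<Rightarrow> 'b set" where
  "setmap_image F A = (\<Union>x\<in>A. F x)"

definition setmap_ker :: "('a \<Rightarrow> 'b::zero set) \<Rightarrow> 'a set" where
  "setmap_ker H = {u. 0 \<in> H u}"

definition closed_around :: "'a::topological_space set \<Rightarrow> 'a \<Rightarrow> bool" where
  "closed_around A u \<longleftrightarrow> u \<in> A \<and> (\<exists>C. closed C \<and> u \<in> interior C \<and> closed (A \<inter> C))"

definition scaled_ball :: "real \<Rightarrow> 'a::real_normed_vector set" where
  "scaled_ball r = (\<lambda>b. r *\<^sub>R b) ` cball 0 1"

text \<open>Extended-real valued, so that the distance to the empty set is \<open>\<infinity>\<close>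
  (unlike \<^const>\<open>infdist\<close>, which is \<open>0\<close> there).\<close>

definition edist :: "'a::real_normed_vector \<Rightarrow> 'a set \<Rightarrow> ereal" where
  "edist x A = (INF z\<in>A. ereal (norm (z - x)))"

text \<open>The sums of sets below are Minkowski sums.\<close>

definition lipschitz_like_rel ::
  "('a::real_normed_vector \<Rightarrow> 'b::real_normed_vector set) \<Rightarrow> 'a set \<Rightarrow> 'b set \<Rightarrow> 'a \<Rightarrow> 'b \<Rightarrow> bool" where
  "lipschitz_like_rel F A C u0 z0 \<longleftrightarrow>
     (u0, z0) \<in> gph (restr F A C) \<and>
     closed_around (gph (restr F A C)) (u0, z0) \<and>
     (\<exists>V W. \<exists>\<kappa>\<ge>0. open V \<and> u0 \<in> V \<and> open W \<and> z0 \<in> W \<and>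
        (\<forall>u\<in>A \<inter> V. \<forall>u'\<in>A \<inter> V.
           F u' \<inter> C \<inter> W \<subseteq> (F u \<inter> C) + scaled_ball (\<kappa> * norm (u' - u))))"

text \<open>On \<^typ>\<open>ereal\<close> one has \<open>0 * \<infinity> = 0\<close>. This convention is immaterial here, since \<open>\<kappa>\<close> may always
  be enlarged to a positive value.\<close>

definition metrically_regular_rel ::
  "('a::real_normed_vector \<Rightarrow> 'b::real_normed_vector set) \<Rightarrow> 'a set \<Rightarrow> 'b set \<Rightarrow> 'a \<Rightarrow> 'b \<Rightarrow> bool" where
  "metrically_regular_rel S \<Omega> \<Theta> x0 y0 \<longleftrightarrow>
     (\<exists>V W. \<exists>\<kappa>\<ge>0. open V \<and> x0 \<in> V \<and> open W \<and> y0 \<in> W \<and>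
        (\<forall>x'\<in>\<Omega> \<inter> V. \<forall>y\<in>\<Theta> \<inter> W.
           edist x' (restr_ran (setmap_inv S) \<Omega> y) \<le> ereal \<kappa> * edist y (restr_ran S \<Theta> x')))"

definition linearly_open_rel ::
  "('a::real_normed_vector \<Rightarrow> 'b::real_normed_vector set) \<Rightarrow> 'a set \<Rightarrow> 'b set \<Rightarrow> 'a \<Rightarrow> 'b \<Rightarrow> bool" where
  "linearly_open_rel S \<Omega> \<Theta> x0 y0 \<longleftrightarrow>
     (\<exists>V W. \<exists>\<kappa>\<ge>0. open V \<and> x0 \<in> V \<and> open W \<and> y0 \<in> W \<and>
        (\<forall>x'\<in>\<Omega> \<inter> V. \<forall>\<epsilon>>0.
           (restr_ran S \<Theta> x' + scaled_ball \<epsilon>) \<inter> \<Theta> \<inter> W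
             \<subseteq> setmap_image (restr_dom S \<Omega>) ({x'} + scaled_ball (\<kappa> * \<epsilon>))))"

text \<open>The dual space of \<^typ>\<open>'a\<close> is \<^typ>\<open>'a \<Rightarrow>\<^sub>L real\<close> with the operator norm.\<close>

definition reflexive_space :: "'a::real_normed_vector itself \<Rightarrow> bool" where
  "reflexive_space _ \<longleftrightarrow>
     (\<forall>\<phi> :: ('a \<Rightarrow>\<^sub>L real) \<Rightarrow>\<^sub>L real. \<exists>x :: 'a. \<forall>f. blinfun_apply \<phi> f = blinfun_apply f x)"

definition locally_uniformly_convex :: "'a::real_normed_vector itself \<Rightarrow> bool" where
  "locally_uniformly_convex _ \<longleftrightarrow>
     (\<forall>x :: 'a. norm x = 1 \<longrightarrow>
        (\<forall>\<epsilon>>0. \<exists>\<delta>>0. \<forall>y. norm y = 1 \<and> norm (x - y) \<ge> \<epsilon> \<longrightarrow> norm ((1/2) *\<^sub>R (x + y)) \<le> 1 - \<delta>))"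

definition reflexive_luc :: "'a::banach itself \<Rightarrow> bool" where
  "reflexive_luc _ \<longleftrightarrow> reflexive_space TYPE('a) \<and>
     locally_uniformly_convex TYPE('a) \<and> locally_uniformly_convex TYPE('a \<Rightarrow>\<^sub>L real)"

definition weak_star_lim :: "(nat \<Rightarrow> 'a::real_normed_vector \<Rightarrow>\<^sub>L real) \<Rightarrow> ('a \<Rightarrow>\<^sub>L real) \<Rightarrow> bool" where
  "weak_star_lim f g \<longleftrightarrow> (\<forall>x. (\<lambda>k. blinfun_apply (f k) x) \<longlonglongrightarrow> blinfun_apply g x)"

definition duality_map :: "'a::real_normed_vector \<Rightarrow> ('a \<Rightarrow>\<^sub>L real) set" where
  "duality_map x = {f. blinfun_apply f x = (norm x)\<^sup>2 \<and> norm f = norm x}"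

definition contingent_cone :: "'a::real_normed_vector \<Rightarrow> 'a set \<Rightarrow> 'a set" where
  "contingent_cone x \<Omega> =
     {z. \<exists>(t :: nat \<Rightarrow> real) w. (\<forall>k. t k > 0) \<and> t \<longlonglongrightarrow> 0 \<and> w \<longlonglongrightarrow> z \<and> (\<forall>k. x + t k *\<^sub>R w k \<in> \<Omega>)}"

text \<open>If \<open>x\<close> is isolated in \<open>\<Omega>\<close>, the limsup is that over the trivial filter, i.e. \<open>-\<infinity>\<close>, and every
  functional is an \<open>\<epsilon>\<close>-normal. There are no \<open>\<epsilon>\<close>-normals at points outside \<open>\<Omega>\<close>.\<close>

definition eps_normals :: "real \<Rightarrow> 'a::real_normed_vector \<Rightarrow> 'a set \<Rightarrow> ('a \<Rightarrow>\<^sub>L real) set" where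
  "eps_normals \<epsilon> x \<Omega> =
     {f. x \<in> \<Omega> \<and>
         Limsup (at x within \<Omega>) (\<lambda>u. ereal (blinfun_apply f (u - x) / norm (u - x))) \<le> ereal \<epsilon>}"

text \<open>The pair \<open>(f, g)\<close> as a functional \<open>(u, v) \<mapsto> f u + g v\<close> on the product space, whose norm in the
  library is the Euclidean one, \<open>sqrt ((norm u)\<^sup>2 + (norm v)\<^sup>2)\<close>.\<close>

definition pair_functional ::
  "('a::real_normed_vector \<Rightarrow>\<^sub>L real) \<Rightarrow> ('b::real_normed_vector \<Rightarrow>\<^sub>L real) \<Rightarrow> ('a \<times> 'b) \<Rightarrow>\<^sub>L real" where
  "pair_functional f g = (f o\<^sub>L fst_blinfun) + (g o\<^sub>L snd_blinfun)"

text \<open>Both the graph normal and the duality-map condition involve \<open>-g\<close>, not \<open>g\<close>.\<close>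

definition mirror_normal ::
  "('a::real_normed_vector \<Rightarrow> 'b::real_normed_vector set) \<Rightarrow> 'a set \<Rightarrow> 'b set \<Rightarrow> real \<Rightarrow> 'a \<Rightarrow> 'b
     \<Rightarrow> ('a \<Rightarrow>\<^sub>L real) \<Rightarrow> ('b \<Rightarrow>\<^sub>L real) \<Rightarrow> bool" where
  "mirror_normal S \<Omega> \<Theta> \<epsilon> x y f g \<longleftrightarrow>
     pair_functional f (- g) \<in> eps_normals \<epsilon> (x, y) (gph (restr S \<Omega> \<Theta>)) \<and>
     f \<in> (\<Union>v\<in>contingent_cone x \<Omega>. duality_map v) \<and>
     - g \<in> (\<Union>w\<in>contingent_cone y \<Theta>. duality_map w)"

definition mirror_coderivative ::
  "('a::real_normed_vector \<Rightarrow> 'b::real_normed_vector set) \<Rightarrow> 'a set \<Rightarrow> 'b set \<Rightarrow> 'a \<Rightarrow> 'b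
     \<Rightarrow> ('b \<Rightarrow>\<^sub>L real) \<Rightarrow> ('a \<Rightarrow>\<^sub>L real) set" where
  "mirror_coderivative S \<Omega> \<Theta> x0 y0 g0 =
     {f0. \<exists>(\<epsilon> :: nat \<Rightarrow> real) x y f g.
        (\<forall>k. \<epsilon> k > 0) \<and> \<epsilon> \<longlonglongrightarrow> 0 \<and>
        (\<forall>k. (x k, y k) \<in> gph (restr S \<Omega> \<Theta>)) \<and> (\<lambda>k. (x k, y k)) \<longlonglongrightarrow> (x0, y0) \<and>
        weak_star_lim g g0 \<and> f \<longlonglongrightarrow> f0 \<and>
        (\<forall>k. mirror_normal S \<Omega> \<Theta> (\<epsilon> k) (x k) (y k) (f k) (g k))}"

definition mirror_PSNC ::
  "('a::real_normed_vector \<Rightarrow> 'b::real_normed_vector set) \<Rightarrow> 'a set \<Rightarrow> 'b set \<Rightarrow> 'a \<Rightarrow> 'b \<Rightarrow> bool" where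
  "mirror_PSNC S \<Omega> \<Theta> x0 y0 \<longleftrightarrow>
     (\<forall>(\<epsilon> :: nat \<Rightarrow> real) x y f g.
        (\<forall>k. 0 < \<epsilon> k \<and> \<epsilon> k < 1) \<and> \<epsilon> \<longlonglongrightarrow> 0 \<and>
        (\<forall>k. (x k, y k) \<in> gph (restr S \<Omega> \<Theta>)) \<and> (\<lambda>k. (x k, y k)) \<longlonglongrightarrow> (x0, y0) \<and>
        f \<longlonglongrightarrow> 0 \<and> weak_star_lim g 0 \<and>
        (\<forall>k. mirror_normal S \<Omega> \<Theta> (\<epsilon> k) (x k) (y k) (f k) (g k))
        \<longrightarrow> (\<lambda>k. norm (g k)) \<longlonglongrightarrow> 0)"

end

theory Submission
  imports Defs "HOL-Complex_Analysis.Great_Picard"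
begin

text \<open>
  The three regularity properties are equivalent by direct estimates, in the cycle from the
  Lipschitz-like property to metric regularity to linear openness and back.

  Lipschitz-like implies the coderivative criterion: if \<open>(f, g)\<close> is a mirror \<open>\<epsilon>\<close>-normal near the reference
  point and \<open>- g\<close> is a duality image of a tangent direction \<open>w\<close> of \<open>\<Theta>\<close>, one moves along \<open>w\<close> in \<open>\<Theta>\<close>
  and lets the Lipschitz-like property supply graph points. Testing the normal on these gives
  \<open>norm g \<le> \<kappa> * norm f + (\<kappa> + 1) * \<epsilon>\<close> (\<open>mirror_normal_norm_bound\<close>), whence both the kernel condition and
  mirror PSNC.

  Conversely, if the Lipschitz-like property fails, Ekeland's variational principle on the graph for
  the distance to a point \<open>y\<close> witnessing the failure gives graph points at which this distance is almost
  minimal but nonzero. The dual of \<open>Y\<close> is locally uniformly convex, so the norm of \<open>Y\<close> is Frechet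
  differentiable away from \<open>0\<close>, and the derivative \<open>g\<close> there is a functional of norm one such that
  \<open>(0, - g)\<close> is an \<open>\<epsilon>\<close>-normal to the graph. Moreover \<open>- g\<close> is the duality image of a unit vector pointing
  towards \<open>y\<close>, which is tangent to \<open>\<Theta>\<close> by convexity (\<open>mirror_normal_of_not_inv_lipschitz\<close>). So
  \<open>(0, g)\<close> is a mirror normal with \<open>norm g = 1\<close>. For \<open>\<epsilon> \<rightarrow> 0\<close>, a subsequence of these \<open>g\<close> converges weak*
  by reflexivity (\<open>weak_star_sequentially_compact\<close>); the kernel condition forces the limit to be \<open>0\<close>, and
  then mirror PSNC contradicts \<open>norm g = 1\<close>.

  The functional-analytic ingredients, namely the Hahn--Banach theorem, differentiability of the norm,
  weak* sequential compactness and Ekeland's principle, are developed first. Local uniform convexity of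
  \<open>Y\<close> itself is used for the compactness only: it reduces pointwise convergence of a sequence of
  functionals on \<open>Y\<close> to convergence on a countable set.
\<close>

section \<open>Sublinear functionals and the Hahn--Banach theorem\<close>

text \<open>Positive homogeneity is required as an inequality only; the reverse inequality follows
  by rescaling, and the inequality is what passes to infima directly.\<close>

definition sublinear :: "('v::real_vector \<Rightarrow> real) \<Rightarrow> bool" where
  "sublinear p \<longleftrightarrow> (\<forall>x y. p (x + y) \<le> p x + p y) \<and> (\<forall>t\<ge>0. \<forall>x. p (t *\<^sub>R x) \<le> t * p x)"

lemma sublinear_add: "sublinear p \<Longrightarrow> p (x + y) \<le> p x + p y"
  by (simp add: sublinear_def)

lemma sublinear_scaleR_le: "sublinear p \<Longrightarrow> 0 \<le> t \<Longrightarrow> p (t *\<^sub>R x) \<le> t * p x"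
  by (simp add: sublinear_def)

lemma sublinear_zero:
  assumes "sublinear p" shows "p 0 = 0"
  using sublinear_scaleR_le[OF assms, of 0 0] sublinear_add[OF assms, of 0 0] by simp

lemma sublinear_uminus:
  assumes "sublinear p" shows "- p (- x) \<le> p x"
  using sublinear_add[OF assms, of x "- x"] sublinear_zero[OF assms] by simp

lemma sublinear_scaleR:
  assumes p: "sublinear p" and t: "0 \<le> t"
  shows "p (t *\<^sub>R x) = t * p x"
proof (cases "t = 0")
  case True
  then show ?thesis using sublinear_zero[OF p] by simp
next
  case False
  with t have "t > 0" by simp
  have "p (inverse t *\<^sub>R (t *\<^sub>R x)) \<le> inverse t * p (t *\<^sub>R x)"
    using \<open>t > 0\<close> by (intro sublinear_scaleR_le[OF p]) simp
  then have "t * p x \<le> p (t *\<^sub>R x)"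
    using \<open>t > 0\<close> by (simp add: field_simps)
  then show ?thesis using sublinear_scaleR_le[OF p t, of x] by simp
qed

lemma sublinear_INF:
  fixes a :: "'i \<Rightarrow> 'v::real_vector \<Rightarrow> real"
  assumes I: "I \<noteq> {}"
    and lower: "\<And>i x. i \<in> I \<Longrightarrow> L x \<le> a i x"
    and add: "\<And>i j x y. i \<in> I \<Longrightarrow> j \<in> I \<Longrightarrow> \<exists>k\<in>I. a k (x + y) \<le> a i x + a j y"
    and scale: "\<And>i t x. i \<in> I \<Longrightarrow> 0 \<le> t \<Longrightarrow> \<exists>k\<in>I. a k (t *\<^sub>R x) \<le> t * a i x"
  shows "sublinear (\<lambda>x. INF i\<in>I. a i x)"
proof -
  have bdd: "bdd_below ((\<lambda>i. a i x) ` I)" for x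
    using lower by (intro bdd_belowI2[where m = "L x"]) auto
  have le: "(INF i\<in>I. a i x) \<le> a i x" if "i \<in> I" for i x
    using bdd that by (rule cINF_lower)
  have "(INF i\<in>I. a i (x + y)) \<le> (INF i\<in>I. a i x) + (INF i\<in>I. a i y)" for x y
  proof -
    have *: "(INF i\<in>I. a i (x + y)) - a i x \<le> (INF i\<in>I. a i y)" if "i \<in> I" for i
    proof (rule cINF_greatest[OF I])
      fix j assume "j \<in> I"
      then obtain k where "k \<in> I" "a k (x + y) \<le> a i x + a j y" using add \<open>i \<in> I\<close> by blast
      then show "(INF i\<in>I. a i (x + y)) - a i x \<le> a j y"
        using le[of k "x + y"] by linarith
    qed
    then have "(INF i\<in>I. a i (x + y)) - (INF i\<in>I. a i y) \<le> a i x" if "i \<in> I" for i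
      using *[OF that] by linarith
    then have "(INF i\<in>I. a i (x + y)) - (INF i\<in>I. a i y) \<le> (INF i\<in>I. a i x)"
      by (intro cINF_greatest[OF I])
    then show ?thesis by linarith
  qed
  moreover have "(INF i\<in>I. a i (t *\<^sub>R x)) \<le> t * (INF i\<in>I. a i x)" if t: "0 \<le> t" for t x
  proof -
    have *: "(INF i\<in>I. a i (t *\<^sub>R x)) \<le> t * a i x" if "i \<in> I" for i
      using scale[OF that t] le by (meson order_trans)
    show ?thesis
    proof (cases "t = 0")
      case True
      then show ?thesis using * I by auto
    next
      case False
      with t have "t > 0" by simp
      have "(INF i\<in>I. a i (t *\<^sub>R x)) / t \<le> (INF i\<in>I. a i x)"
        using * \<open>t > 0\<close> by (intro cINF_greatest[OF I]) (simp add: field_simps)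
      then show ?thesis using \<open>t > 0\<close> by (simp add: field_simps)
    qed
  qed
  ultimately show ?thesis by (auto simp: sublinear_def)
qed

lemma exists_minimal_sublinear:
  fixes p :: "'v::real_vector \<Rightarrow> real"
  assumes p: "sublinear p"
  shows "\<exists>q. sublinear q \<and> q \<le> p \<and> (\<forall>r. sublinear r \<and> r \<le> q \<longrightarrow> r = q)"
proof -
  define A where "A = {q. sublinear q \<and> q \<le> p}"
  define P where "P = (\<lambda>q r :: 'v \<Rightarrow> real. r \<le> q)"
  have "\<exists>m\<in>A. \<forall>a\<in>A. P m a \<longrightarrow> a = m"
  proof (rule predicate_Zorn)
    show "partial_order_on A (relation_of P A)"
      by (rule partial_order_on_relation_ofI) (auto simp: P_def)
  next
    fix C assume "C \<in> Chains (relation_of P A)"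
    then have CA: "C \<subseteq> A" and tot: "\<And>q r. q \<in> C \<Longrightarrow> r \<in> C \<Longrightarrow> q \<le> r \<or> r \<le> q"
      by (auto simp: Chains_def relation_of_def P_def)
    show "\<exists>u\<in>A. \<forall>a\<in>C. P a u"
    proof (cases "C = {}")
      case True
      then show ?thesis using p by (auto simp: A_def)
    next
      case False
      have lower: "- p (- x) \<le> q x" if "q \<in> C" for q x
      proof -
        have "sublinear q" "q (- x) \<le> p (- x)" using that CA by (auto simp: A_def le_fun_def)
        then show ?thesis using sublinear_uminus[of q x] by linarith
      qed
      define u where "u = (\<lambda>x. INF q\<in>C. q x)"
      have below: "u x \<le> q x" if "q \<in> C" for q x
        unfolding u_def using that lower
        by (intro cINF_lower bdd_belowI2[where m = "- p (- x)"]) auto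
      have "sublinear u"
        unfolding u_def
      proof (rule sublinear_INF[OF False, of "\<lambda>x. - p (- x)"])
        fix q x assume "q \<in> C" then show "- p (- x) \<le> q x" by (rule lower)
      next
        fix q r x y assume qr: "q \<in> C" "r \<in> C"
        show "\<exists>k\<in>C. k (x + y) \<le> q x + r y"
        proof (cases "q \<le> r")
          case True
          have "q (x + y) \<le> q x + q y" using qr CA by (auto simp: A_def intro: sublinear_add)
          moreover have "q y \<le> r y" using True by (simp add: le_fun_def)
          ultimately show ?thesis using qr(1) by (intro bexI[of _ q]) linarith+
        next
          case False
          then have "r \<le> q" using tot qr by blast
          have "r (x + y) \<le> r x + r y" using qr CA by (auto simp: A_def intro: sublinear_add)
          moreover have "r x \<le> q x" using \<open>r \<le> q\<close> by (simp add: le_fun_def)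
          ultimately show ?thesis using qr(2) by (intro bexI[of _ r]) linarith+
        qed
      next
        fix q t x assume "q \<in> C" "0 \<le> (t::real)"
        then show "\<exists>k\<in>C. k (t *\<^sub>R x) \<le> t * q x"
          using CA by (intro bexI[of _ q]) (auto simp: A_def intro: sublinear_scaleR_le)
      qed
      moreover obtain q where "q \<in> C" using False by blast
      then have "q \<le> p" "u \<le> q" using below CA by (auto simp: A_def le_fun_def)
      then have "u \<le> p" by (rule order_trans[rotated])
      ultimately have "u \<in> A" by (simp add: A_def)
      moreover have "\<forall>a\<in>C. P a u" using below by (simp add: P_def le_fun_def)
      ultimately show ?thesis by blast
    qed
  qed
  then obtain q where "q \<in> A" and q: "\<And>a. a \<in> A \<Longrightarrow> a \<le> q \<Longrightarrow> a = q" by (auto simp: P_def)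
  have "r = q" if "sublinear r" "r \<le> q" for r
  proof (rule q)
    have "q \<le> p" using \<open>q \<in> A\<close> by (simp add: A_def)
    then show "r \<in> A" using that order_trans[of r q p] by (simp add: A_def)
  qed (rule that)
  then show ?thesis using \<open>q \<in> A\<close> by (auto simp: A_def)
qed

text \<open>A minimal sublinear functional \<open>q\<close> is linear: for each \<open>v\<close> the functional
  \<open>x \<mapsto> inf {q (x + t v) - t q v | t \<ge> 0}\<close> is sublinear and below \<open>q\<close>, hence equal to \<open>q\<close>,
  and its value is at most \<open>q (x + v) - q v\<close>.\<close>

lemma sublinear_linear_minorant:
  fixes p :: "'v::real_vector \<Rightarrow> real"
  assumes "sublinear p"
  shows "\<exists>q. linear q \<and> (\<forall>x. q x \<le> p x)"
proof -
  obtain q where q: "sublinear q" and qp: "q \<le> p"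
    and minimal: "\<And>r. sublinear r \<Longrightarrow> r \<le> q \<Longrightarrow> r = q"
    using exists_minimal_sublinear[OF assms] by blast
  have add: "q (x + v) = q x + q v" for x v
  proof -
    define r where "r = (\<lambda>x. INF t\<in>{0..}. q (x + t *\<^sub>R v) - t * q v)"
    have lower: "- q (- x) \<le> q (x + t *\<^sub>R v) - t * q v" if "t \<ge> 0" for t x
      using sublinear_add[OF q, of "x + t *\<^sub>R v" "- x"] sublinear_scaleR[OF q that, of v] by simp
    have below: "r x \<le> q (x + t *\<^sub>R v) - t * q v" if "t \<ge> 0" for t x
      unfolding r_def using that lower
      by (intro cINF_lower bdd_belowI2[where m = "- q (- x)"]) auto
    have "sublinear r"
      unfolding r_def
    proof (rule sublinear_INF[where L = "\<lambda>x. - q (- x)"])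
      fix s t x y assume "s \<in> {0::real..}" "t \<in> {0::real..}"
      moreover have "q (x + y + (s + t) *\<^sub>R v) \<le> q (x + s *\<^sub>R v) + q (y + t *\<^sub>R v)"
        using sublinear_add[OF q, of "x + s *\<^sub>R v" "y + t *\<^sub>R v"] by (simp add: algebra_simps)
      ultimately show "\<exists>k\<in>{0..}. q (x + y + k *\<^sub>R v) - k * q v
          \<le> (q (x + s *\<^sub>R v) - s * q v) + (q (y + t *\<^sub>R v) - t * q v)"
        by (intro bexI[of _ "s + t"]) (auto simp: algebra_simps)
    next
      fix s t x assume "s \<in> {0::real..}" "0 \<le> (t::real)"
      then show "\<exists>k\<in>{0..}. q (t *\<^sub>R x + k *\<^sub>R v) - k * q v \<le> t * (q (x + s *\<^sub>R v) - s * q v)"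
        using sublinear_scaleR[OF q, of t "x + s *\<^sub>R v"]
        by (intro bexI[of _ "t * s"]) (auto simp: algebra_simps)
    qed (use lower in auto)
    moreover have "r \<le> q" using below[of 0] by (auto simp: le_fun_def)
    ultimately have "r = q" by (rule minimal)
    then have "q x \<le> q (x + v) - q v" using below[of 1 x] by simp
    then show ?thesis using sublinear_add[OF q, of x v] by linarith
  qed
  have neg: "q (- x) = - q x" for x using add[of x "- x"] sublinear_zero[OF q] by simp
  have "q (t *\<^sub>R x) = t *\<^sub>R q x" for t x
  proof (cases "t \<ge> 0")
    case True
    then show ?thesis using sublinear_scaleR[OF q] by simp
  next
    case False
    then show ?thesis using sublinear_scaleR[OF q, of "- t" x] neg[of "t *\<^sub>R x"] by simp
  qed
  then have "linear q" using add by (intro linearI)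
  then show ?thesis using qp by (auto simp: le_fun_def)
qed

theorem hahn_banach_sublinear:
  fixes p l :: "'v::real_vector \<Rightarrow> real"
  assumes p: "sublinear p" and l: "linear l" and M: "subspace M"
    and le: "\<And>m. m \<in> M \<Longrightarrow> l m \<le> p m"
  shows "\<exists>q. linear q \<and> (\<forall>m\<in>M. q m = l m) \<and> (\<forall>x. q x \<le> p x)"
proof -
  define r where "r = (\<lambda>x. INF m\<in>M. p (x - m) + l m)"
  have lower: "- p (- x) \<le> p (x - m) + l m" if "m \<in> M" for m x
  proof -
    have "l (- m) \<le> p (- m)" using that M by (intro le subspace_neg)
    also have "\<dots> \<le> p (x - m) + p (- x)" using sublinear_add[OF p, of "x - m" "- x"] by simp
    finally show ?thesis using linear_neg[OF l] by simp
  qed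
  have below: "r x \<le> p (x - m) + l m" if "m \<in> M" for m x
    unfolding r_def using that lower
    by (intro cINF_lower bdd_belowI2[where m = "- p (- x)"]) auto
  have "sublinear r"
    unfolding r_def
  proof (rule sublinear_INF[where L = "\<lambda>x. - p (- x)"])
    show "M \<noteq> {}" using subspace_0[OF M] by blast
  next
    fix m n x y assume "m \<in> M" "n \<in> M"
    then show "\<exists>k\<in>M. p (x + y - k) + l k \<le> (p (x - m) + l m) + (p (y - n) + l n)"
      using M sublinear_add[OF p, of "x - m" "y - n"] linear_add[OF l, of m n]
      by (intro bexI[of _ "m + n"]) (auto simp: algebra_simps subspace_add)
  next
    fix m t x assume "m \<in> M" "0 \<le> (t::real)"
    then show "\<exists>k\<in>M. p (t *\<^sub>R x - k) + l k \<le> t * (p (x - m) + l m)"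
      using M sublinear_scaleR[OF p, of t "x - m"] linear_scale[OF l, of t m]
      by (intro bexI[of _ "t *\<^sub>R m"]) (auto simp: algebra_simps subspace_scale)
  qed (use lower in auto)
  then obtain q where q: "linear q" and qr: "\<And>x. q x \<le> r x"
    using sublinear_linear_minorant by blast
  have qM: "q m \<le> l m" if "m \<in> M" for m
    using qr[of m] below[OF that, of m] sublinear_zero[OF p] by simp
  have "q m = l m" if "m \<in> M" for m
    using qM[OF that] qM[OF subspace_neg[OF M that]] linear_neg[OF q, of m] linear_neg[OF l, of m]
    by linarith
  moreover have "q x \<le> p x" for x
    using qr[of x] below[OF subspace_0[OF M], of x] linear_0[OF l] by simp
  ultimately show ?thesis using q by blast
qed

corollary hahn_banach_norm:
  fixes l :: "'v::real_normed_vector \<Rightarrow> real"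
  assumes l: "linear l" and M: "subspace M" and c: "0 \<le> c"
    and le: "\<And>m. m \<in> M \<Longrightarrow> l m \<le> c * norm m"
  shows "\<exists>F :: 'v \<Rightarrow>\<^sub>L real. (\<forall>m\<in>M. blinfun_apply F m = l m) \<and> norm F \<le> c"
proof -
  have "sublinear (\<lambda>x::'v. c * norm x)"
    using c by (auto simp: sublinear_def ring_distribs[symmetric] intro!: mult_left_mono norm_triangle_ineq)
  then obtain q where q: "linear q" and qM: "\<And>m. m \<in> M \<Longrightarrow> q m = l m" and qc: "\<And>x. q x \<le> c * norm x"
    using hahn_banach_sublinear[OF _ l M le] by blast
  have bound: "norm (q x) \<le> c * norm x" for x
    using qc[of x] qc[of "- x"] linear_neg[OF q] by (simp add: abs_if)
  then have "bounded_linear q"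
    using q by (intro bounded_linear_intro[of q c]) (auto simp: linear_add linear_scale mult.commute)
  then have "blinfun_apply (Blinfun q) = q" by (rule bounded_linear_Blinfun_apply)
  then show ?thesis using qM bound c by (intro exI[of _ "Blinfun q"]) (auto intro: norm_blinfun_bound)
qed

lemma norming_functional:
  fixes x :: "'v::real_normed_vector"
  assumes "x \<noteq> 0"
  shows "\<exists>F :: 'v \<Rightarrow>\<^sub>L real. norm F = 1 \<and> blinfun_apply F x = norm x"
proof -
  have "independent {x}" using assms by (simp add: dependent_single)
  then obtain l :: "'v \<Rightarrow> real" where l: "linear l" and lx: "l x = norm x"
    using linear_independent_extend[of "{x}" norm] by blast
  have "l m \<le> 1 * norm m" if "m \<in> span {x}" for m
  proof -
    obtain t where "m = t *\<^sub>R x" using \<open>m \<in> span {x}\<close> by (auto simp: span_singleton)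
    then show ?thesis using linear_scale[OF l, of t x] lx by (simp add: mult_right_mono)
  qed
  then obtain F :: "'v \<Rightarrow>\<^sub>L real" where F: "\<And>m. m \<in> span {x} \<Longrightarrow> F m = l m" "norm F \<le> 1"
    using hahn_banach_norm[OF l subspace_span, of 1 "{x}"] by auto
  have "F x = norm x" using F(1)[of x] lx by (simp add: span_base)
  then have "norm x \<le> norm F * norm x" using norm_blinfun[of F x] by simp
  then show ?thesis using F(2) \<open>F x = norm x\<close> assms by (intro exI[of _ F]) simp
qed

section \<open>Smoothness of the norm\<close>

text \<open>Smulian's argument. Norming functionals of \<open>x + h\<close> almost norm \<open>x\<close> when \<open>h\<close> is small, so local
  uniform convexity of the dual at \<open>f\<close> forces them to be close to \<open>f\<close>.\<close>

lemma norm_frechet_upper_estimate: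
  fixes x :: "'v::real_normed_vector" and f :: "'v \<Rightarrow>\<^sub>L real"
  assumes luc: "locally_uniformly_convex TYPE('v \<Rightarrow>\<^sub>L real)"
    and x: "x \<noteq> 0" and f: "norm f = 1" "blinfun_apply f x = norm x" and \<epsilon>: "\<epsilon> > 0"
  shows "\<exists>\<delta>>0. \<forall>h. norm h < \<delta> \<longrightarrow> norm (x + h) \<le> norm x + blinfun_apply f h + \<epsilon> * norm h"
proof -
  obtain d where d: "d > 0"
    and luc_f: "\<And>g. norm g = 1 \<Longrightarrow> norm (f - g) \<ge> \<epsilon> \<Longrightarrow> norm ((1/2) *\<^sub>R (f + g)) \<le> 1 - d"
    using luc f(1) \<epsilon> unfolding locally_uniformly_convex_def by metis
  have "norm (x + h) \<le> norm x + f h + \<epsilon> * norm h" if h: "norm h < min 1 d * norm x" for h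
  proof -
    have "min 1 d * norm x \<le> norm x"
      using mult_right_mono[of "min 1 d" 1 "norm x"] by simp
    then have "x + h \<noteq> 0" using h norm_minus_cancel[of h] by (auto simp: add_eq_0_iff)
    then obtain g :: "'v \<Rightarrow>\<^sub>L real" where g: "norm g = 1" "g (x + h) = norm (x + h)"
      using norming_functional by blast
    have gx: "g x \<le> norm x" and gh: "g h \<le> norm h"
      using norm_blinfun[of g x] norm_blinfun[of g h] g(1) by auto
    have "norm (f - g) < \<epsilon>"
    proof (rule ccontr)
      assume "\<not> norm (f - g) < \<epsilon>"
      then have "norm ((1/2) *\<^sub>R (f + g)) \<le> 1 - d" using luc_f g(1) by simp
      then have "norm (((1/2) *\<^sub>R (f + g)) x) \<le> (1 - d) * norm x"
        using norm_blinfun[of "(1/2) *\<^sub>R (f + g)" x] mult_right_mono by (metis norm_ge_zero order_trans)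
      then have "norm x + g x \<le> 2 * norm x - 2 * (d * norm x)"
        using f(2) by (simp add: plus_blinfun.rep_eq scaleR_blinfun.rep_eq algebra_simps)
      moreover have "g x \<ge> norm x - 2 * norm h"
        using g(2) gh norm_triangle_ineq2[of x "- h"] by (simp add: blinfun.add_right)
      ultimately have "d * norm x \<le> norm h" by linarith
      moreover have "min 1 d * norm x \<le> d * norm x" by (simp add: mult_right_mono)
      ultimately show False using h by linarith
    qed
    then have "(g - f) h \<le> \<epsilon> * norm h"
      using norm_blinfun[of "g - f" h] mult_right_mono[of "norm (g - f)" \<epsilon> "norm h"]
      by (simp add: norm_minus_commute)
    then show ?thesis
      using g(2) gx by (simp add: blinfun.add_right minus_blinfun.rep_eq)
  qed
  then show ?thesis using x d by (intro exI[of _ "min 1 d * norm x"]) simp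
qed

section \<open>Weak* sequential compactness in the dual of a reflexive space\<close>

lemma countable_dense_in_span:
  fixes B :: "'v::real_normed_vector set"
  assumes B: "countable B"
  shows "\<exists>R. countable R \<and> R \<subseteq> span B \<and> span B \<subseteq> closure R"
proof -
  define comb where "comb l = (\<Sum>(q, b)\<leftarrow>l. real_of_rat q *\<^sub>R b)" for l :: "(rat \<times> 'v) list"
  define R where "R = comb ` lists (UNIV \<times> B)"
  have "countable R" unfolding R_def using B by (intro countable_image countable_lists) auto
  moreover have "R \<subseteq> span B"
  proof -
    have "comb l \<in> span B" if "set l \<subseteq> UNIV \<times> B" for l
      using that unfolding comb_def
      by (induction l) (auto intro: span_add span_scale span_base span_zero)
    then show ?thesis by (auto simp: R_def lists_eq_set)
  qed
  moreover have "x \<in> closure R" if "x \<in> span B" for x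
    using that
  proof (induction rule: span_induct_alt)
    case base
    have "comb [] \<in> R" unfolding R_def by (intro imageI) simp
    then show ?case using closure_subset by (auto simp: comb_def)
  next
    case (step c b y)
    show ?case
      unfolding closure_approachable
    proof (intro allI impI)
      fix e :: real assume "e > 0"
      have "e / (2 * (norm b + 1)) > 0" using \<open>e > 0\<close> by (simp add: add_nonneg_pos)
      then obtain q where "c < real_of_rat q" "real_of_rat q < c + e / (2 * (norm b + 1))"
        using of_rat_dense[of c "c + e / (2 * (norm b + 1))"] by auto
      then have "\<bar>real_of_rat q - c\<bar> < e / (2 * (norm b + 1))" by linarith
      then have "\<bar>real_of_rat q - c\<bar> * (2 * (norm b + 1)) < e"
        by (subst (asm) pos_less_divide_eq) (auto intro: add_nonneg_pos)
      moreover have "2 * (\<bar>real_of_rat q - c\<bar> * norm b) \<le> \<bar>real_of_rat q - c\<bar> * (2 * (norm b + 1))"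
        by (simp add: algebra_simps)
      ultimately have "\<bar>real_of_rat q - c\<bar> * norm b < e / 2" by linarith
      then have 1: "norm ((real_of_rat q - c) *\<^sub>R b) < e / 2"
        by simp
      obtain l where l: "l \<in> lists (UNIV \<times> B)" "dist (comb l) y < e / 2"
        using step(2) half_gt_zero[OF \<open>e > 0\<close>] unfolding closure_approachable R_def by blast
      have eq: "comb ((q, b) # l) - (c *\<^sub>R b + y) = (real_of_rat q - c) *\<^sub>R b + (comb l - y)"
        by (simp add: comb_def algebra_simps)
      have "dist (comb ((q, b) # l)) (c *\<^sub>R b + y) < e"
        using norm_triangle_ineq[of "(real_of_rat q - c) *\<^sub>R b" "comb l - y"] 1 l(2)
        unfolding dist_norm eq by linarith
      moreover have "comb ((q, b) # l) \<in> R"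
        unfolding R_def using l(1) step(1) by (intro imageI) simp
      ultimately show "\<exists>y'\<in>R. dist y' (c *\<^sub>R b + y) < e" by blast
    qed
  qed
  ultimately show ?thesis by blast
qed

lemma near_norming_unit_vector:
  fixes f :: "'v::real_normed_vector \<Rightarrow>\<^sub>L real"
  assumes f: "f \<noteq> 0" and \<eta>: "0 < \<eta>" "\<eta> \<le> 1"
  shows "\<exists>x. norm x = 1 \<and> blinfun_apply f x \<ge> (1 - \<eta>) * norm f"
proof (rule ccontr)
  assume "\<not> ?thesis"
  then have lt: "f u \<le> (1 - \<eta>) * norm f" if "norm u = 1" for u using that by force
  have one_sided: "f x \<le> ((1 - \<eta>) * norm f) * norm x" for x
  proof (cases "x = 0")
    case False
    then have "f ((1 / norm x) *\<^sub>R x) \<le> (1 - \<eta>) * norm f" by (intro lt) simp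
    then show ?thesis using False by (simp add: blinfun.scaleR_right field_simps)
  qed simp
  then have "norm (f x) \<le> ((1 - \<eta>) * norm f) * norm x" for x
    using one_sided[of x] one_sided[of "- x"] by (simp add: blinfun.minus_right abs_if)
  then have "norm f \<le> (1 - \<eta>) * norm f" using \<eta> by (intro norm_blinfun_bound) auto
  then show False using f \<eta> by (simp add: algebra_simps mult_le_0_iff)
qed

lemma closed_convergent_blinfun:
  fixes f :: "nat \<Rightarrow> 'v::real_normed_vector \<Rightarrow>\<^sub>L real"
  assumes bound: "\<And>k. norm (f k) \<le> B" 
  shows "closed {x. convergent (\<lambda>k. blinfun_apply (f k) x)}"
proof -
  have B: "B \<ge> 0" using bound[of 0] norm_ge_zero order_trans by blast
  have "convergent (\<lambda>k. f k x)" if x: "x \<in> closure {x. convergent (\<lambda>k. f k x)}" for x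
  proof (rule Cauchy_convergent, rule metric_CauchyI)
    fix e :: real assume e: "e > 0"
    have "e / (3 * (B + 1)) > 0" using e B by simp
    then obtain d where d: "convergent (\<lambda>k. f k d)" "dist d x < e / (3 * (B + 1))"
      using x unfolding closure_approachable by blast
    have "dist d x * (B + 1) < e / 3" using d(2) B by (simp add: field_simps)
    moreover have "B * norm (x - d) \<le> dist d x * (B + 1)"
      by (simp add: dist_norm norm_minus_commute algebra_simps)
    ultimately have dB: "B * norm (x - d) < e / 3" by linarith
    have near: "\<bar>f k x - f k d\<bar> < e / 3" for k
    proof -
      have "\<bar>f k x - f k d\<bar> \<le> norm (f k) * norm (x - d)"
        using norm_blinfun[of "f k" "x - d"] by (simp add: blinfun.diff_right)
      also have "\<dots> \<le> B * norm (x - d)" using bound by (intro mult_right_mono) auto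
      finally show ?thesis using dB by linarith
    qed
    obtain N where N: "\<And>m n. m \<ge> N \<Longrightarrow> n \<ge> N \<Longrightarrow> dist (f m d) (f n d) < e / 3"
      using metric_CauchyD[OF convergent_Cauchy[OF d(1)], of "e / 3"] e by auto
    have "dist (f m x) (f n x) < e" if "m \<ge> N" "n \<ge> N" for m n
      using near[of m] near[of n] N[OF that] unfolding dist_real_def by linarith
    then show "\<exists>N. \<forall>m\<ge>N. \<forall>n\<ge>N. dist (f m x) (f n x) < e" by blast
  qed
  then show ?thesis by (subst closure_subset_eq[symmetric]) blast
qed

lemma weak_star_lim_of_convergent:
  fixes f :: "nat \<Rightarrow> 'v::real_normed_vector \<Rightarrow>\<^sub>L real"
  assumes bound: "\<And>k. norm (f k) \<le> B" and conv: "\<And>x. convergent (\<lambda>k. blinfun_apply (f k) x)"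
  shows "\<exists>g. weak_star_lim f g"
proof -
  define g where "g x = lim (\<lambda>k. f k x)" for x
  have lim: "(\<lambda>k. f k x) \<longlonglongrightarrow> g x" for x
    unfolding g_def using conv by (simp add: convergent_LIMSEQ_iff)
  have "bounded_linear g"
  proof (rule bounded_linear_intro[of g B])
    fix x y show "g (x + y) = g x + g y"
      using tendsto_add[OF lim[of x] lim[of y]] lim[of "x + y"]
      by (auto simp: blinfun.add_right intro: LIMSEQ_unique)
  next
    fix r x show "g (r *\<^sub>R x) = r *\<^sub>R g x"
      using tendsto_scaleR[OF tendsto_const lim[of x]] lim[of "r *\<^sub>R x"]
      by (auto simp: blinfun.scaleR_right intro: LIMSEQ_unique)
  next
    fix x
    have "norm (f k x) \<le> norm x * B" for k
      using norm_blinfun[of "f k" x] mult_right_mono[OF bound[of k], of "norm x"]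
      by (simp add: mult.commute)
    then show "norm (g x) \<le> norm x * B"
      by (intro LIMSEQ_le_const2[OF tendsto_norm[OF lim]]) auto
  qed
  then show ?thesis
    using lim by (intro exI[of _ "Blinfun g"]) (simp add: weak_star_lim_def bounded_linear_Blinfun_apply)
qed

text \<open>On a subspace \<open>M\<close> of the dual, every point \<open>y\<close> acts like a point \<open>x\<close> whose norm is attained, in the
  limit, on the unit ball of \<open>M\<close>: extend the evaluation at \<open>y\<close> from \<open>M\<close> to the dual with the same norm and represent the
  extension by reflexivity.\<close>

lemma reflexive_norm_preserving_representative:
  fixes y :: "'v::real_normed_vector" and M :: "('v \<Rightarrow>\<^sub>L real) set"
  assumes refl: "reflexive_space TYPE('v)" and M: "subspace M"
  shows "\<exists>x. (\<forall>m\<in>M. blinfun_apply m x = blinfun_apply m y) \<and>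
    (\<forall>e>0. \<exists>m\<in>M. norm m \<le> 1 \<and> blinfun_apply m x > norm x - e)"
proof -
  define K where "K = {m \<in> M. norm m \<le> 1}"
  define c where "c = (SUP m\<in>K. blinfun_apply m y)"
  have K0: "0 \<in> K" using subspace_0[OF M] by (simp add: K_def)
  have "blinfun_apply m y \<le> norm y" if "m \<in> K" for m
    using norm_blinfun[of m y] that mult_right_mono[of "norm m" 1 "norm y"] by (auto simp: K_def)
  then have bdd: "bdd_above ((\<lambda>m. blinfun_apply m y) ` K)" by (intro bdd_aboveI2) auto
  have le_c: "blinfun_apply m y \<le> c" if "m \<in> K" for m
    unfolding c_def using bdd that by (intro cSUP_upper) auto
  have c: "c \<ge> 0" using le_c[OF K0] by simp
  have "blinfun_apply m y \<le> c * norm m" if "m \<in> M" for m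
  proof (cases "m = 0")
    case False
    have "(1 / norm m) *\<^sub>R m \<in> K" using that M False by (simp add: K_def subspace_scale)
    then have "blinfun_apply ((1 / norm m) *\<^sub>R m) y \<le> c" by (rule le_c)
    then show ?thesis using False by (simp add: scaleR_blinfun.rep_eq field_simps)
  qed simp
  moreover have "linear (\<lambda>m :: 'v \<Rightarrow>\<^sub>L real. blinfun_apply m y)"
    by (intro linearI) (auto simp: plus_blinfun.rep_eq scaleR_blinfun.rep_eq)
  ultimately obtain F :: "('v \<Rightarrow>\<^sub>L real) \<Rightarrow>\<^sub>L real"
    where F: "\<And>m. m \<in> M \<Longrightarrow> blinfun_apply F m = blinfun_apply m y" "norm F \<le> c"
    using hahn_banach_norm[OF _ M c] by blast
  obtain x where x: "\<And>h. blinfun_apply F h = blinfun_apply h x"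
    using refl unfolding reflexive_space_def by blast
  have "norm x \<le> c"
  proof (cases "x = 0")
    case False
    then obtain h :: "'v \<Rightarrow>\<^sub>L real" where "norm h = 1" "blinfun_apply h x = norm x"
      using norming_functional by blast
    then show ?thesis using norm_blinfun[of F h] F(2) x[of h] by simp
  qed (use c in simp)
  have "\<exists>m\<in>M. norm m \<le> 1 \<and> blinfun_apply m x > norm x - e" if "e > 0" for e
  proof -
    have "c - e < c" using that by simp
    then obtain m where "m \<in> K" "blinfun_apply m y > c - e"
      unfolding c_def using less_cSUP_iff[OF _ bdd] K0 by blast
    then show ?thesis using \<open>norm x \<le> c\<close> F(1)[of m] x[of m] by (intro bexI[of _ m]) (auto simp: K_def)
  qed
  then show ?thesis using F(1) x by metis
qed

text \<open>Since a near-norming unit vector of a functional that almost norms \<open>x\<close> is close to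
  \<open>x / norm x\<close> by local uniform convexity, the representatives of the previous lemma lie in the closed
  cone over countably many vectors. Convergence on these, which a diagonal argument provides, is
  therefore convergence everywhere.\<close>

theorem weak_star_sequentially_compact:
  fixes f :: "nat \<Rightarrow> 'v::real_normed_vector \<Rightarrow>\<^sub>L real"
  assumes refl: "reflexive_space TYPE('v)" and luc: "locally_uniformly_convex TYPE('v)"
    and bound: "\<And>k. norm (f k) \<le> B"
  shows "\<exists>g r. strict_mono r \<and> weak_star_lim (f \<circ> r) g"
proof -
  define M where "M = span (range f)"
  have M: "subspace M" unfolding M_def by simp
  obtain R where R: "countable R" "R \<subseteq> M" "M \<subseteq> closure R"
    using countable_dense_in_span[of "range f"] unfolding M_def by auto
  define d where "d m n = (SOME x. norm x = 1 \<and>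
    blinfun_apply m x \<ge> (1 - inverse (Suc n)) * norm m)" for m :: "'v \<Rightarrow>\<^sub>L real" and n :: nat
  have d: "norm (d m n) = 1 \<and> blinfun_apply m (d m n) \<ge> (1 - inverse (Suc n)) * norm m"
    if "m \<noteq> 0" for m n
    unfolding d_def
    by (rule someI_ex, rule near_norming_unit_vector[OF that]) (auto simp: field_simps)
  define D where "D = (\<lambda>(m, n). d m n) ` (R \<times> UNIV)"
  have "countable D" unfolding D_def using R(1) by auto
  \<comment> \<open>If \<open>0 \<in> R\<close>, the vector \<open>d 0 n\<close> is arbitrary, so long vectors are discarded.\<close>
  define D1 where "D1 = {x \<in> D. norm x \<le> 1}"
  have "norm (blinfun_apply (f k) x) \<le> B" if "x \<in> D1" for k x
  proof -
    have "norm (blinfun_apply (f k) x) \<le> norm (f k) * norm x" by (rule norm_blinfun)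
    also have "\<dots> \<le> B * 1"
      using that bound[of k] order_trans[OF norm_ge_zero bound[of k]]
      by (intro mult_mono) (auto simp: D1_def)
    finally show ?thesis by simp
  qed
  moreover have "countable D1" using \<open>countable D\<close> by (auto simp: D1_def)
  ultimately obtain r where r: "strict_mono (r::nat \<Rightarrow> nat)"
    and conv: "\<And>x. x \<in> D1 \<Longrightarrow> \<exists>l. (\<lambda>k. blinfun_apply (f (r k)) x) \<longlonglongrightarrow> l"
    using function_convergent_subsequence[of D1 "\<lambda>k. blinfun_apply (f k)" B] by blast
  define C where "C = {x. convergent (\<lambda>k. blinfun_apply (f (r k)) x)}"
  have "closed C" unfolding C_def by (rule closed_convergent_blinfun) (rule bound)
  have D1C: "D1 \<subseteq> C" using conv by (auto simp: C_def convergent_def)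
  have "y \<in> C" for y
  proof -
    obtain x where xy: "\<And>m. m \<in> M \<Longrightarrow> blinfun_apply m x = blinfun_apply m y"
      and att: "\<And>e. e > 0 \<Longrightarrow> \<exists>m\<in>M. norm m \<le> 1 \<and> blinfun_apply m x > norm x - e"
      using reflexive_norm_preserving_representative[OF refl M, of y] by blast
    have "x \<in> C"
    proof (cases "x = 0")
      case True
      then show ?thesis by (simp add: C_def convergent_const)
    next
      case False
      define u where "u = (1 / norm x) *\<^sub>R x"
      have u: "norm u = 1" using False by (simp add: u_def)
      have "\<exists>v\<in>D1. dist v u < e" if "e > 0" for e
      proof -
        obtain \<delta> where \<delta>: "\<delta> > 0"
          and luc_u: "\<And>v. norm v = 1 \<Longrightarrow> norm (u - v) \<ge> e \<Longrightarrow> norm ((1/2) *\<^sub>R (u + v)) \<le> 1 - \<delta>"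
          using luc u \<open>e > 0\<close> unfolding locally_uniformly_convex_def by metis
        define \<eta> where "\<eta> = min (1/4) (\<delta> / 4)"
        have \<eta>: "\<eta> > 0" "\<eta> \<le> 1/4" "\<eta> \<le> \<delta> / 4" using \<delta> by (auto simp: \<eta>_def)
        have "\<eta> * norm x > 0" using \<eta> False by simp
        then obtain m0 where m0: "m0 \<in> M" "norm m0 \<le> 1" "blinfun_apply m0 x > norm x - \<eta> * norm x"
          using att by blast
        have m0u: "blinfun_apply m0 u > 1 - \<eta>"
          using m0(3) False by (simp add: u_def blinfun.scaleR_right field_simps)
        obtain m where m: "m \<in> R" "dist m m0 < \<eta>"
          using subsetD[OF R(3) m0(1)] \<eta>(1) unfolding closure_approachable by blast
        have "norm m \<le> 1 + \<eta>" using m(2) m0(2) norm_triangle_ineq2[of m m0] by (simp add: dist_norm)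
        have "\<bar>blinfun_apply (m - m0) u\<bar> \<le> \<eta>"
          using norm_blinfun[of "m - m0" u] m(2) u by (simp add: dist_norm)
        then have mu: "blinfun_apply m u > 1 - 2 * \<eta>"
          using m0u by (simp add: minus_blinfun.rep_eq)
        then have mnorm: "norm m > 1 - 2 * \<eta>" using norm_blinfun[of m u] u by simp
        then have "m \<noteq> 0" using \<eta> by auto
        obtain n where n: "inverse (real (Suc n)) < \<eta>" using reals_Archimedean[OF \<eta>(1)] by blast
        define v where "v = d m n"
        have v: "norm v = 1" "blinfun_apply m v \<ge> (1 - inverse (Suc n)) * norm m"
          using d[OF \<open>m \<noteq> 0\<close>] by (auto simp: v_def)
        have "blinfun_apply m v \<ge> (1 - \<eta>) * (1 - 2 * \<eta>)"
        proof -
          have "(1 - \<eta>) * (1 - 2 * \<eta>) \<le> (1 - inverse (Suc n)) * norm m"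
            using n mnorm \<eta> by (intro mult_mono) auto
          then show ?thesis using v(2) by linarith
        qed
        then have "blinfun_apply m (u + v) > (1 - 2 * \<eta>) * (2 - \<eta>)"
          using mu by (simp add: blinfun.add_right algebra_simps)
        moreover have "blinfun_apply m (u + v) \<le> (1 + \<eta>) * norm (u + v)"
          using norm_blinfun[of m "u + v"] mult_right_mono[OF \<open>norm m \<le> 1 + \<eta>\<close>, of "norm (u + v)"] by simp
        ultimately have big: "(1 - 2 * \<eta>) * (2 - \<eta>) < (1 + \<eta>) * norm (u + v)" by linarith
        have "norm (u - v) < e"
        proof (rule ccontr)
          assume "\<not> norm (u - v) < e"
          then have "norm (u + v) \<le> 2 * (1 - \<delta>)" using luc_u[OF v(1)] by simp
          also have "\<dots> \<le> 2 * (1 - 4 * \<eta>)" using \<eta> by simp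
          finally have "(1 + \<eta>) * norm (u + v) \<le> (1 + \<eta>) * (2 * (1 - 4 * \<eta>))"
            using \<eta> by (intro mult_left_mono) auto
          with big have "(1 - 2 * \<eta>) * (2 - \<eta>) < (1 + \<eta>) * (2 * (1 - 4 * \<eta>))" by linarith
          then have "\<eta> + 10 * (\<eta> * \<eta>) < 0" by (simp add: algebra_simps)
          moreover have "\<eta> * \<eta> \<ge> 0" by simp
          ultimately show False using \<eta>(1) by linarith
        qed
        moreover have "v \<in> D1" using m(1) v(1) by (auto simp: D1_def D_def v_def)
        ultimately show ?thesis by (intro bexI[of _ v]) (simp add: dist_norm norm_minus_commute)
      qed
      then have "u \<in> closure D1" unfolding closure_approachable by blast
      then have "u \<in> C" using closure_minimal[OF D1C \<open>closed C\<close>] by blast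
      moreover have "blinfun_apply (f (r k)) x = norm x * blinfun_apply (f (r k)) u" for k
        using False by (simp add: u_def blinfun.scaleR_right)
      ultimately show ?thesis
        by (simp add: C_def convergent_mult convergent_const)
    qed
    moreover have "blinfun_apply (f (r k)) x = blinfun_apply (f (r k)) y" for k
      by (intro xy) (simp add: M_def span_base)
    ultimately show ?thesis by (simp add: C_def)
  qed
  then have "convergent (\<lambda>k. blinfun_apply ((f \<circ> r) k) y)" for y by (auto simp: C_def)
  moreover have "norm ((f \<circ> r) k) \<le> B" for k using bound by simp
  ultimately obtain g where "weak_star_lim (f \<circ> r) g"
    using weak_star_lim_of_convergent[of "f \<circ> r" B] by blast
  then show ?thesis using r by blast
qed

section \<open>Ekeland's variational principle\<close>

theorem ekeland_variational_principle:
  fixes \<phi> :: "'m::complete_space \<Rightarrow> real"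
  assumes K: "closed K" and u0: "u0 \<in> K" and cont: "continuous_on K \<phi>"
    and lower: "\<And>w. w \<in> K \<Longrightarrow> b \<le> \<phi> w" and \<mu>: "\<mu> > 0"
  shows "\<exists>u\<in>K. \<phi> u + \<mu> * dist u u0 \<le> \<phi> u0 \<and> (\<forall>w\<in>K. w \<noteq> u \<longrightarrow> \<phi> u < \<phi> w + \<mu> * dist w u)"
proof -
  define T where "T u = {w \<in> K. \<phi> w + \<mu> * dist w u \<le> \<phi> u}" for u
  have T_self: "u \<in> T u" if "u \<in> K" for u using that by (simp add: T_def)
  have T_K: "T u \<subseteq> K" for u by (auto simp: T_def)
  have T_closed: "closed (T u)" for u
    unfolding T_def by (intro continuous_on_closed_Collect_le K cont continuous_intros)
  have T_trans: "T w \<subseteq> T u" if "w \<in> T u" for u w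
  proof
    fix v assume "v \<in> T w"
    moreover have "\<mu> * dist v u \<le> \<mu> * dist v w + \<mu> * dist w u"
      using mult_left_mono[OF dist_triangle[of v u w], of \<mu>] \<mu> by (simp add: distrib_left)
    ultimately show "v \<in> T u" using that unfolding T_def by auto
  qed
  have bdd: "bdd_below (\<phi> ` T u)" for u using lower T_K by (intro bdd_belowI2[of _ b]) auto
  have "\<exists>w\<in>T u. \<phi> w < (INF v\<in>T u. \<phi> v) + (1/2) ^ n" if "u \<in> K" for u n
    using cINF_less_iff[OF _ bdd, of u "(INF v\<in>T u. \<phi> v) + (1/2) ^ n"] T_self[OF that] by force
  then have ex: "\<exists>w. w \<in> T u \<and> \<phi> w < (INF v\<in>T u. \<phi> v) + (1/2) ^ n" if "u \<in> K" for u n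
    using that by blast
  define s where "s n u = (SOME w. w \<in> T u \<and> \<phi> w < (INF v\<in>T u. \<phi> v) + (1/2) ^ n)" for n u
  have s: "s n u \<in> T u \<and> \<phi> (s n u) < (INF v\<in>T u. \<phi> v) + (1/2) ^ n" if "u \<in> K" for u n
    unfolding s_def by (rule someI_ex[OF ex[OF that]])
  define z where "z = rec_nat u0 s"
  have z_Suc: "z (Suc n) = s n (z n)" for n by (simp add: z_def)
  have zK: "z n \<in> K" for n
    by (induction n) (use u0 s T_K in \<open>auto simp: z_def\<close>)
  have step: "z (Suc n) \<in> T (z n)" "\<phi> (z (Suc n)) < (INF v\<in>T (z n). \<phi> v) + (1/2) ^ n" for n
    using s[OF zK] by (auto simp: z_Suc)
  have mono: "T (z n) \<subseteq> T (z m)" if "m \<le> n" for m n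
    using that by (rule lift_Suc_antimono_le[rotated]) (rule T_trans[OF step(1)])
  have radius: "\<mu> * dist w (z (Suc n)) \<le> (1/2) ^ n" if w: "w \<in> T (z (Suc n))" for w n
  proof -
    have "w \<in> T (z n)" using w mono[of n "Suc n"] by auto
    then have "(INF v\<in>T (z n). \<phi> v) \<le> \<phi> w" by (intro cINF_lower bdd)
    moreover have "\<phi> w + \<mu> * dist w (z (Suc n)) \<le> \<phi> (z (Suc n))" using w by (simp add: T_def)
    ultimately show ?thesis using step(2)[of n] by linarith
  qed
  have small: "\<exists>n. \<forall>x\<in>T (z n). \<forall>y\<in>T (z n). dist x y < e" if "e > 0" for e
  proof -
    have "\<mu> * e / 2 > 0" using \<mu> that by simp
    then obtain n where n: "(1/2) ^ n < \<mu> * e / 2" using real_arch_pow_inv[of "\<mu> * e / 2" "1/2"] by auto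
    have "dist x y < e" if "x \<in> T (z (Suc n))" "y \<in> T (z (Suc n))" for x y
    proof -
      have "\<mu> * dist x y \<le> \<mu> * dist x (z (Suc n)) + \<mu> * dist y (z (Suc n))"
        using mult_left_mono[OF dist_triangle2[of x y "z (Suc n)"], of \<mu>] \<mu> by (simp add: distrib_left)
      then have "\<mu> * dist x y < \<mu> * e" using radius that n by (smt (verit) field_sum_of_halves)
      then show ?thesis using \<mu> by simp
    qed
    then show ?thesis by blast
  qed
  obtain u where u: "\<Inter> (range (\<lambda>n. T (z n))) = {u}"
    using decreasing_closed_nest_sing[of "\<lambda>n. T (z n)"] T_closed T_self[OF zK] mono small by blast
  then have uT: "u \<in> T (z n)" for n by blast
  have "u \<in> K" "\<phi> u + \<mu> * dist u u0 \<le> \<phi> u0" using uT[of 0] by (auto simp: T_def z_def)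
  moreover have "\<phi> u < \<phi> w + \<mu> * dist w u" if "w \<in> K" "w \<noteq> u" for w
  proof (rule ccontr)
    assume "\<not> \<phi> u < \<phi> w + \<mu> * dist w u"
    then have "w \<in> T u" using that by (simp add: T_def)
    then have "w \<in> T (z n)" for n using T_trans[OF uT] by blast
    then show False using u that(2) by blast
  qed
  ultimately show ?thesis by blast
qed

section \<open>Equivalent forms of relative regularity\<close>

lemma mem_scaled_ball_iff:
  assumes "0 \<le> r" shows "z \<in> scaled_ball r \<longleftrightarrow> norm z \<le> r"
proof
  assume "z \<in> scaled_ball r"
  then obtain b where "norm b \<le> 1" "z = r *\<^sub>R b" by (auto simp: scaled_ball_def)
  then show "norm z \<le> r" using assms by (simp add: mult_left_le)
next
  assume z: "norm z \<le> r"
  show "z \<in> scaled_ball r"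
  proof (cases "r = 0")
    case True
    then show ?thesis using z by (auto simp: scaled_ball_def intro!: image_eqI[of _ _ 0])
  next
    case False
    then show ?thesis
      using z assms by (auto simp: scaled_ball_def intro!: image_eqI[of _ _ "(1 / r) *\<^sub>R z"])
  qed
qed

lemma mem_plus_scaled_ball_iff:
  assumes "0 \<le> r" shows "z \<in> A + scaled_ball r \<longleftrightarrow> (\<exists>a\<in>A. norm (z - a) \<le> r)"
proof
  assume "z \<in> A + scaled_ball r"
  then obtain a b where "a \<in> A" "norm b \<le> r" "z = a + b"
    by (auto simp: set_plus_def mem_scaled_ball_iff[OF assms])
  then show "\<exists>a\<in>A. norm (z - a) \<le> r" by (intro bexI[of _ a]) auto
next
  assume "\<exists>a\<in>A. norm (z - a) \<le> r"
  then obtain a where a: "a \<in> A" "norm (z - a) \<le> r" by blast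
  then have "a + (z - a) \<in> A + scaled_ball r"
    by (intro set_plus_intro) (auto simp: mem_scaled_ball_iff[OF assms])
  then show "z \<in> A + scaled_ball r" by simp
qed

lemma gph_restr_iff: "(x, y) \<in> gph (restr S \<Omega> \<Theta>) \<longleftrightarrow> x \<in> \<Omega> \<and> y \<in> \<Theta> \<and> y \<in> S x"
  by (auto simp: gph_def restr_def)

lemma closed_around_gph_inv:
  fixes S :: "'a::topological_space \<Rightarrow> 'b::topological_space set"
  assumes "closed_around (gph (restr S \<Omega> \<Theta>)) (x0, y0)"
  shows "closed_around (gph (restr (setmap_inv S) \<Theta> \<Omega>)) (y0, x0)"
proof -
  obtain C where C: "closed C" "(x0, y0) \<in> interior C" "closed (gph (restr S \<Omega> \<Theta>) \<inter> C)"
    and x0y0: "(x0, y0) \<in> gph (restr S \<Omega> \<Theta>)"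
    using assms by (auto simp: closed_around_def)
  let ?sw = "prod.swap :: 'b \<times> 'a \<Rightarrow> 'a \<times> 'b"
  have gph_eq: "gph (restr (setmap_inv S) \<Theta> \<Omega>) = ?sw -` gph (restr S \<Omega> \<Theta>)"
    by (auto simp: gph_restr_iff setmap_inv_def)
  have cont: "continuous_on UNIV ?sw" by (simp add: prod.swap_def continuous_intros)
  have "open (?sw -` interior C)" by (rule open_vimage[OF open_interior cont])
  then have "(y0, x0) \<in> interior (?sw -` C)"
    using C(2) by (intro interiorI) (auto dest: subsetD[OF interior_subset])
  moreover have "closed (?sw -` C)" "closed (?sw -` (gph (restr S \<Omega> \<Theta>) \<inter> C))"
    by (rule closed_vimage[OF C(1) cont], rule closed_vimage[OF C(3) cont])
  ultimately show ?thesis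
    using x0y0 unfolding closed_around_def gph_eq by (auto simp: vimage_Int intro!: exI[of _ "?sw -` C"])
qed

text \<open>The Lipschitz-like property of \<open>S\<^sup>-\<^sup>1\<close> without its closedness requirement, with a radius in place
  of the two neighbourhoods.\<close>

definition inv_lipschitz_on_ball ::
  "('a::real_normed_vector \<Rightarrow> 'b::real_normed_vector set) \<Rightarrow> 'a set \<Rightarrow> 'b set \<Rightarrow> 'a \<Rightarrow> 'b \<Rightarrow> real \<Rightarrow> real \<Rightarrow> bool"
  where "inv_lipschitz_on_ball S \<Omega> \<Theta> x0 y0 \<delta> \<kappa> \<longleftrightarrow>
    (\<forall>x'\<in>\<Omega>. \<forall>y'\<in>\<Theta>. \<forall>y\<in>\<Theta>. y' \<in> S x' \<longrightarrow> norm (x' - x0) < \<delta> \<longrightarrow> norm (y' - y0) < \<delta> \<longrightarrow> norm (y - y0) < \<delta> \<longrightarrow>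
       (\<exists>x\<in>\<Omega>. y \<in> S x \<and> norm (x' - x) \<le> \<kappa> * norm (y' - y)))"

lemma inv_lipschitz_on_ballD:
  assumes "inv_lipschitz_on_ball S \<Omega> \<Theta> x0 y0 \<delta> \<kappa>" "x' \<in> \<Omega>" "y' \<in> \<Theta>" "y \<in> \<Theta>" "y' \<in> S x'"
    "norm (x' - x0) < \<delta>" "norm (y' - y0) < \<delta>" "norm (y - y0) < \<delta>"
  obtains x where "x \<in> \<Omega>" "y \<in> S x" "norm (x' - x) \<le> \<kappa> * norm (y' - y)"
  using assms unfolding inv_lipschitz_on_ball_def by blast

lemma lipschitz_like_inv_iff:
  fixes S :: "'a::real_normed_vector \<Rightarrow> 'b::real_normed_vector set"
  assumes cl: "closed_around (gph (restr S \<Omega> \<Theta>)) (x0, y0)"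
  shows "lipschitz_like_rel (setmap_inv S) \<Theta> \<Omega> y0 x0 \<longleftrightarrow>
    (\<exists>\<delta>>0. \<exists>\<kappa>\<ge>0. inv_lipschitz_on_ball S \<Omega> \<Theta> x0 y0 \<delta> \<kappa>)" (is "?L \<longleftrightarrow> ?R")
proof
  assume ?L
  then obtain V W \<kappa> where \<kappa>: "\<kappa> \<ge> 0" and V: "open V" "y0 \<in> V" and W: "open W" "x0 \<in> W"
    and sub: "\<And>y y'. y \<in> \<Theta> \<inter> V \<Longrightarrow> y' \<in> \<Theta> \<inter> V \<Longrightarrow>
      setmap_inv S y' \<inter> \<Omega> \<inter> W \<subseteq> (setmap_inv S y \<inter> \<Omega>) + scaled_ball (\<kappa> * norm (y' - y))"
    unfolding lipschitz_like_rel_def by blast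
  obtain d1 where d1: "d1 > 0" "ball y0 d1 \<subseteq> V" using V open_contains_ball by blast
  obtain d2 where d2: "d2 > 0" "ball x0 d2 \<subseteq> W" using W open_contains_ball by blast
  have "inv_lipschitz_on_ball S \<Omega> \<Theta> x0 y0 (min d1 d2) \<kappa>"
    unfolding inv_lipschitz_on_ball_def
  proof (intro ballI impI)
    fix x' y' y
    assume A: "x' \<in> \<Omega>" "y' \<in> \<Theta>" "y \<in> \<Theta>" "y' \<in> S x'" "norm (x' - x0) < min d1 d2"
      "norm (y' - y0) < min d1 d2" "norm (y - y0) < min d1 d2"
    then have "y \<in> V" "y' \<in> V" "x' \<in> W"
      using d1(2) d2(2) by (auto simp: subset_iff dist_norm norm_minus_commute)
    then have "x' \<in> (setmap_inv S y \<inter> \<Omega>) + scaled_ball (\<kappa> * norm (y' - y))"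
      using A by (intro subsetD[OF sub]) (auto simp: setmap_inv_def)
    then show "\<exists>x\<in>\<Omega>. y \<in> S x \<and> norm (x' - x) \<le> \<kappa> * norm (y' - y)"
      using \<kappa> by (subst (asm) mem_plus_scaled_ball_iff) (auto simp: setmap_inv_def)
  qed
  then show ?R using \<kappa> d1(1) d2(1) by (intro exI[of _ "min d1 d2"]) auto
next
  assume ?R
  then obtain \<delta> \<kappa> where \<delta>: "\<delta> > 0" and \<kappa>: "\<kappa> \<ge> 0" and R: "inv_lipschitz_on_ball S \<Omega> \<Theta> x0 y0 \<delta> \<kappa>"
    by blast
  have "setmap_inv S y' \<inter> \<Omega> \<inter> ball x0 \<delta> \<subseteq> (setmap_inv S y \<inter> \<Omega>) + scaled_ball (\<kappa> * norm (y' - y))"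
    if y: "y \<in> \<Theta> \<inter> ball y0 \<delta>" "y' \<in> \<Theta> \<inter> ball y0 \<delta>" for y y'
  proof
    fix x' assume x': "x' \<in> setmap_inv S y' \<inter> \<Omega> \<inter> ball x0 \<delta>"
    obtain x where "x \<in> \<Omega>" "y \<in> S x" "norm (x' - x) \<le> \<kappa> * norm (y' - y)"
    proof (rule inv_lipschitz_on_ballD[OF R, of x' y' y])
    qed (use x' y in \<open>auto simp: setmap_inv_def dist_norm norm_minus_commute\<close>)
    with \<kappa> show "x' \<in> (setmap_inv S y \<inter> \<Omega>) + scaled_ball (\<kappa> * norm (y' - y))"
      by (subst mem_plus_scaled_ball_iff) (auto simp: setmap_inv_def)
  qed
  then show ?L
    unfolding lipschitz_like_rel_def
    using closed_around_gph_inv[OF cl] \<delta> \<kappa>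
    by (intro conjI exI[of _ "ball y0 \<delta>"] exI[of _ "ball x0 \<delta>"] exI[of _ \<kappa>])
      (auto simp: closed_around_def)
qed

lemma edist_le: "z \<in> A \<Longrightarrow> edist x A \<le> ereal (norm (z - x))"
  unfolding edist_def by (rule INF_lower)

lemma edist_less_iff: "edist x A < ereal r \<longleftrightarrow> (\<exists>z\<in>A. norm (z - x) < r)"
  unfolding edist_def by (simp add: INF_less_iff)

lemma inv_lipschitz_imp_metrically_regular:
  assumes S0: "x0 \<in> \<Omega>" "y0 \<in> \<Theta>" "y0 \<in> S x0" and \<delta>: "\<delta> > 0" and \<kappa>: "\<kappa> \<ge> 0"
    and lip: "inv_lipschitz_on_ball S \<Omega> \<Theta> x0 y0 \<delta> \<kappa>"
  shows "metrically_regular_rel S \<Omega> \<Theta> x0 y0"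
proof -
  have "edist x' (restr_ran (setmap_inv S) \<Omega> y) \<le> ereal (\<kappa> + 1) * edist y (restr_ran S \<Theta> x')"
    if x': "x' \<in> \<Omega> \<inter> ball x0 (\<delta> / 2)" and y: "y \<in> \<Theta> \<inter> ball y0 (\<delta> / 2)" for x' y
  proof -
    have x'0: "norm (x' - x0) < \<delta> / 2" and y0: "norm (y - y0) < \<delta> / 2"
      using x' y by (auto simp: dist_norm norm_minus_commute)
    have bound: "edist x' (restr_ran (setmap_inv S) \<Omega> y) \<le> ereal ((\<kappa> + 1) * norm (y' - y))"
      if y': "y' \<in> restr_ran S \<Theta> x'" for y'
    proof -
      have "\<exists>x\<in>\<Omega>. y \<in> S x \<and> norm (x - x') \<le> (\<kappa> + 1) * norm (y' - y)"
      proof (cases "norm (y' - y0) < \<delta>")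
        case True
        obtain x where x: "x \<in> \<Omega>" "y \<in> S x" "norm (x' - x) \<le> \<kappa> * norm (y' - y)"
        proof (rule inv_lipschitz_on_ballD[OF lip, of x' y' y])
          show "norm (x' - x0) < \<delta>" "norm (y - y0) < \<delta>" using x'0 y0 \<delta> by auto
        qed (use x' y y' True in \<open>auto simp: restr_ran_def\<close>)
        have "\<kappa> * norm (y' - y) \<le> (\<kappa> + 1) * norm (y' - y)" by (simp add: mult_right_mono)
        then show ?thesis using x by (intro bexI[of _ x]) (auto simp: norm_minus_commute)
      next
        \<comment> \<open>A far away \<open>y'\<close> gives no information, but then the right-hand side is at least
          \<open>(\<kappa> + 1) * \<delta> / 2\<close>, and comparison with the reference point suffices.\<close>
        case False
        obtain x where x: "x \<in> \<Omega>" "y \<in> S x" "norm (x0 - x) \<le> \<kappa> * norm (y0 - y)"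
        proof (rule inv_lipschitz_on_ballD[OF lip, of x0 y0 y])
          show "norm (y - y0) < \<delta>" using y0 \<delta> by auto
        qed (use S0 y \<delta> in auto)
        have far: "norm (y' - y) \<ge> \<delta> / 2"
          using False y0 norm_triangle_ineq[of "y' - y" "y - y0"] by simp
        have "norm (x - x') \<le> norm (x0 - x) + norm (x' - x0)"
          using norm_triangle_ineq[of "x - x0" "x0 - x'"] by (simp add: norm_minus_commute)
        also have "\<dots> \<le> \<kappa> * (\<delta> / 2) + \<delta> / 2"
        proof -
          have "\<kappa> * norm (y0 - y) \<le> \<kappa> * (\<delta> / 2)"
            using y0 \<kappa> by (intro mult_left_mono) (auto simp: norm_minus_commute)
          then show ?thesis using x(3) x'0 by linarith
        qed
        also have "\<dots> = (\<kappa> + 1) * (\<delta> / 2)" by (simp add: algebra_simps)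
        also have "\<dots> \<le> (\<kappa> + 1) * norm (y' - y)" using far \<kappa> by (intro mult_left_mono) auto
        finally show ?thesis using x by blast
      qed
      then obtain x where x: "x \<in> restr_ran (setmap_inv S) \<Omega> y" "norm (x - x') \<le> (\<kappa> + 1) * norm (y' - y)"
        by (auto simp: restr_ran_def setmap_inv_def)
      show ?thesis using edist_le[OF x(1), of x'] x(2) by (meson ereal_less_eq(3) order_trans)
    qed
    have "edist x' (restr_ran (setmap_inv S) \<Omega> y) / ereal (\<kappa> + 1) \<le> edist y (restr_ran S \<Theta> x')"
      unfolding edist_def[of y]
      using \<kappa> bound by (intro INF_greatest) (subst ereal_divide_le_pos, auto)
    then show ?thesis using \<kappa> by (subst (asm) ereal_divide_le_pos) auto
  qed
  then show ?thesis
    unfolding metrically_regular_rel_def using \<delta> \<kappa>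
    by (intro exI[of _ "ball x0 (\<delta> / 2)"] exI[of _ "ball y0 (\<delta> / 2)"] exI[of _ "\<kappa> + 1"]) auto
qed

lemma metrically_regular_imp_linearly_open:
  assumes "metrically_regular_rel S \<Omega> \<Theta> x0 y0"
  shows "linearly_open_rel S \<Omega> \<Theta> x0 y0"
proof -
  obtain V W \<kappa> where \<kappa>: "\<kappa> \<ge> 0" and VW: "open V" "x0 \<in> V" "open W" "y0 \<in> W"
    and reg: "\<And>x' y. x' \<in> \<Omega> \<inter> V \<Longrightarrow> y \<in> \<Theta> \<inter> W \<Longrightarrow>
      edist x' (restr_ran (setmap_inv S) \<Omega> y) \<le> ereal \<kappa> * edist y (restr_ran S \<Theta> x')"
    using assms unfolding metrically_regular_rel_def by blast
  have "(restr_ran S \<Theta> x' + scaled_ball \<epsilon>) \<inter> \<Theta> \<inter> W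
      \<subseteq> setmap_image (restr_dom S \<Omega>) ({x'} + scaled_ball ((\<kappa> + 1) * \<epsilon>))"
    if x': "x' \<in> \<Omega> \<inter> V" and \<epsilon>: "\<epsilon> > 0" for x' \<epsilon>
  proof
    fix y assume y: "y \<in> (restr_ran S \<Theta> x' + scaled_ball \<epsilon>) \<inter> \<Theta> \<inter> W"
    then obtain y' where y': "y' \<in> restr_ran S \<Theta> x'" "norm (y - y') \<le> \<epsilon>"
      using \<epsilon> mem_plus_scaled_ball_iff[of \<epsilon> y "restr_ran S \<Theta> x'"] by auto
    have "edist y (restr_ran S \<Theta> x') \<le> ereal \<epsilon>"
      using edist_le[OF y'(1), of y] y'(2) by (simp add: norm_minus_commute order_trans[of _ "ereal (norm (y' - y))"])
    then have "ereal \<kappa> * edist y (restr_ran S \<Theta> x') \<le> ereal \<kappa> * ereal \<epsilon>"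
      using \<kappa> by (intro ereal_mult_left_mono) auto
    also have "\<dots> < ereal ((\<kappa> + 1) * \<epsilon>)" using \<epsilon> by simp
    finally have "edist x' (restr_ran (setmap_inv S) \<Omega> y) < ereal ((\<kappa> + 1) * \<epsilon>)"
      using reg[OF x', of y] y by (auto intro: le_less_trans)
    then obtain x where x: "x \<in> \<Omega>" "y \<in> S x" "norm (x - x') < (\<kappa> + 1) * \<epsilon>"
      by (auto simp: edist_less_iff restr_ran_def setmap_inv_def)
    then have "x \<in> {x'} + scaled_ball ((\<kappa> + 1) * \<epsilon>)"
      using \<kappa> \<epsilon> by (subst mem_plus_scaled_ball_iff) auto
    then show "y \<in> setmap_image (restr_dom S \<Omega>) ({x'} + scaled_ball ((\<kappa> + 1) * \<epsilon>))"
      using x by (auto simp: setmap_image_def restr_dom_def)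
  qed
  then show ?thesis
    unfolding linearly_open_rel_def using VW \<kappa>
    by (intro exI[of _ V] exI[of _ W] exI[of _ "\<kappa> + 1"]) auto
qed

lemma linearly_open_imp_inv_lipschitz:
  assumes "linearly_open_rel S \<Omega> \<Theta> x0 y0"
  shows "\<exists>\<delta>>0. \<exists>\<kappa>\<ge>0. inv_lipschitz_on_ball S \<Omega> \<Theta> x0 y0 \<delta> \<kappa>"
proof -
  obtain V W \<kappa> where \<kappa>: "\<kappa> \<ge> 0" and V: "open V" "x0 \<in> V" and W: "open W" "y0 \<in> W"
    and lop: "\<And>x' \<epsilon>. x' \<in> \<Omega> \<inter> V \<Longrightarrow> \<epsilon> > 0 \<Longrightarrow>
      (restr_ran S \<Theta> x' + scaled_ball \<epsilon>) \<inter> \<Theta> \<inter> W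
        \<subseteq> setmap_image (restr_dom S \<Omega>) ({x'} + scaled_ball (\<kappa> * \<epsilon>))"
    using assms unfolding linearly_open_rel_def by blast
  obtain d1 where d1: "d1 > 0" "ball x0 d1 \<subseteq> V" using V open_contains_ball by blast
  obtain d2 where d2: "d2 > 0" "ball y0 d2 \<subseteq> W" using W open_contains_ball by blast
  have "inv_lipschitz_on_ball S \<Omega> \<Theta> x0 y0 (min d1 d2) \<kappa>"
    unfolding inv_lipschitz_on_ball_def
  proof (intro ballI impI)
    fix x' y' y
    assume A: "x' \<in> \<Omega>" "y' \<in> \<Theta>" "y \<in> \<Theta>" "y' \<in> S x'" "norm (x' - x0) < min d1 d2"
      "norm (y' - y0) < min d1 d2" "norm (y - y0) < min d1 d2"
    show "\<exists>x\<in>\<Omega>. y \<in> S x \<and> norm (x' - x) \<le> \<kappa> * norm (y' - y)"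
    proof (cases "y' = y")
      case True
      then show ?thesis using A by (intro bexI[of _ x']) auto
    next
      case False
      then have pos: "norm (y' - y) > 0" by simp
      have "y \<in> restr_ran S \<Theta> x' + scaled_ball (norm (y' - y))"
        using A by (subst mem_plus_scaled_ball_iff)
          (auto simp: restr_ran_def norm_minus_commute intro!: bexI[of _ y'])
      moreover have "y \<in> W" "x' \<in> V"
        using A d1(2) d2(2) by (auto simp: subset_iff dist_norm norm_minus_commute)
      ultimately have "y \<in> setmap_image (restr_dom S \<Omega>) ({x'} + scaled_ball (\<kappa> * norm (y' - y)))"
        using lop[OF _ pos, of x'] A by blast
      then obtain x where "x \<in> \<Omega>" "y \<in> S x" "x \<in> {x'} + scaled_ball (\<kappa> * norm (y' - y))"
        by (auto simp: setmap_image_def restr_dom_def split: if_splits)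
      then show ?thesis
        using \<kappa> by (subst (asm) mem_plus_scaled_ball_iff) (auto simp: norm_minus_commute)
    qed
  qed
  then show ?thesis using \<kappa> d1(1) d2(1) by (intro exI[of _ "min d1 d2"]) auto
qed

section \<open>Mirror normals\<close>

lemma pair_functional_apply:
  "blinfun_apply (pair_functional f g) p = blinfun_apply f (fst p) + blinfun_apply g (snd p)"
  by (simp add: pair_functional_def plus_blinfun.rep_eq fst_blinfun.rep_eq snd_blinfun.rep_eq)

lemma zero_in_contingent_cone: "x \<in> \<Omega> \<Longrightarrow> 0 \<in> contingent_cone x \<Omega>"
  unfolding contingent_cone_def
  by (intro CollectI exI[of _ "\<lambda>n. inverse (real (Suc n))"] exI[of _ "\<lambda>_. 0"])
    (use LIMSEQ_inverse_real_of_nat in auto)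

lemma zero_in_duality_image: "x \<in> \<Omega> \<Longrightarrow> 0 \<in> (\<Union>v\<in>contingent_cone x \<Omega>. duality_map v)"
  using zero_in_contingent_cone[of x \<Omega>] by (intro UN_I[of 0]) (auto simp: duality_map_def)

lemma convex_direction_in_contingent_cone:
  assumes "convex \<Theta>" and y: "y \<in> \<Theta>" "z \<in> \<Theta>" and s: "s > 0"
  shows "s *\<^sub>R (z - y) \<in> contingent_cone y \<Theta>"
proof -
  define t where "t n = inverse s * inverse (real (Suc n))" for n
  have "t \<longlonglongrightarrow> inverse s * 0"
    unfolding t_def by (intro tendsto_mult tendsto_const LIMSEQ_inverse_real_of_nat)
  moreover have "y + t n *\<^sub>R (s *\<^sub>R (z - y)) \<in> \<Theta>" for n
  proof -
    have "(1 - inverse (real (Suc n))) *\<^sub>R y + inverse (real (Suc n)) *\<^sub>R z \<in> \<Theta>"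
      using assms by (intro convexD) (auto simp: field_simps)
    also have "(1 - inverse (real (Suc n))) *\<^sub>R y + inverse (real (Suc n)) *\<^sub>R z =
        y + inverse (real (Suc n)) *\<^sub>R (z - y)"
      by (simp only: scaleR_diff_left scaleR_diff_right scaleR_one) simp
    also have "inverse (real (Suc n)) *\<^sub>R (z - y) = t n *\<^sub>R (s *\<^sub>R (z - y))"
      using s by (simp add: t_def)
    finally show ?thesis .
  qed
  ultimately show ?thesis
    unfolding contingent_cone_def using s
    by (intro CollectI exI[of _ t] exI[of _ "\<lambda>_. s *\<^sub>R (z - y)"]) (auto simp: t_def)
qed

lemma eps_normals_lessD:
  assumes f: "f \<in> eps_normals \<epsilon> p G" and e: "\<epsilon> < e"
  shows "\<exists>\<rho>>0. \<forall>q\<in>G. dist q p < \<rho> \<longrightarrow> blinfun_apply f (q - p) \<le> e * norm (q - p)"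
proof -
  have "Limsup (at p within G) (\<lambda>u. ereal (blinfun_apply f (u - p) / norm (u - p))) < ereal e"
    using f e unfolding eps_normals_def by (auto intro: le_less_trans)
  then have "\<forall>\<^sub>F u in at p within G. ereal (blinfun_apply f (u - p) / norm (u - p)) < ereal e"
    by (rule Limsup_lessD)
  then obtain \<rho> where \<rho>: "\<rho> > 0"
    "\<And>q. q \<in> G \<Longrightarrow> q \<noteq> p \<Longrightarrow> dist q p < \<rho> \<Longrightarrow> blinfun_apply f (q - p) / norm (q - p) < e"
    unfolding eventually_at by auto
  have "blinfun_apply f (q - p) \<le> e * norm (q - p)" if "q \<in> G" "dist q p < \<rho>" for q
  proof (cases "q = p")
    case False
    then show ?thesis using \<rho>(2)[OF that(1) False that(2)] by (simp add: pos_divide_less_eq)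
  qed simp
  then show ?thesis using \<rho>(1) by blast
qed

lemma eps_normalsI:
  assumes "p \<in> G" "\<forall>\<^sub>F q in at p within G. blinfun_apply f (q - p) \<le> \<epsilon> * norm (q - p)" "0 \<le> \<epsilon>"
  shows "f \<in> eps_normals \<epsilon> p G"
proof -
  have "\<forall>\<^sub>F q in at p within G. ereal (blinfun_apply f (q - p) / norm (q - p)) \<le> ereal \<epsilon>"
    using assms(2)
  proof eventually_elim
    case (elim q)
    then show ?case using assms(3) by (cases "q = p") (auto simp: pos_divide_le_eq)
  qed
  then show ?thesis using assms(1) by (auto simp: eps_normals_def intro: Limsup_bounded)
qed

text \<open>Under the Lipschitz-like estimate a mirror normal \<open>(f, g)\<close> has \<open>g\<close> controlled by \<open>f\<close>: move
  \<open>y\<close> along the tangent direction \<open>w\<close> with \<open>- g \<in> J w\<close>, along which \<open>- g\<close> grows at rate \<open>norm w\<^sup>2\<close>, and follow with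
  \<open>x\<close> at speed at most \<open>\<kappa> * norm w\<close>.\<close>

lemma mirror_normal_norm_bound:
  assumes lip: "inv_lipschitz_on_ball S \<Omega> \<Theta> x0 y0 \<delta> \<kappa>" and \<kappa>: "\<kappa> \<ge> 0" and \<epsilon>: "\<epsilon> \<ge> 0"
    and xy: "(x, y) \<in> gph (restr S \<Omega> \<Theta>)" "norm (x - x0) < \<delta>" "norm (y - y0) < \<delta>"
    and normal: "mirror_normal S \<Omega> \<Theta> \<epsilon> x y f g"
  shows "norm g \<le> \<kappa> * norm f + (\<kappa> + 1) * \<epsilon>"
proof (rule field_le_epsilon)
  fix e :: real assume e: "e > 0"
  define G where "G = gph (restr S \<Omega> \<Theta>)"
  \<comment> \<open>A margin above \<open>\<epsilon>\<close>, chosen so that \<open>(\<kappa> + 1) * e' = (\<kappa> + 1) * \<epsilon> + e\<close>.\<close>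
  define e' where "e' = \<epsilon> + e / (\<kappa> + 1)"
  have e': "\<epsilon> < e'" "0 \<le> e'" "(\<kappa> + 1) * e' = (\<kappa> + 1) * \<epsilon> + e"
    using e \<kappa> \<epsilon> by (auto simp: e'_def distrib_left)
  define c where "c = \<kappa> * norm f + (\<kappa> + 1) * e'"
  have c: "c \<ge> 0" unfolding c_def using \<kappa> e'(2) by (intro add_nonneg_nonneg mult_nonneg_nonneg) auto
  obtain w where w: "w \<in> contingent_cone y \<Theta>" "- g \<in> duality_map w"
    using normal by (auto simp: mirror_normal_def)
  have gw: "- blinfun_apply g w = (norm w)\<^sup>2" and norm_g: "norm g = norm w"
    using w(2) by (auto simp: duality_map_def uminus_blinfun.rep_eq)
  obtain t v where t: "\<And>n. t n > 0" "t \<longlonglongrightarrow> 0" and v: "v \<longlonglongrightarrow> w" and tv: "\<And>n. y + t n *\<^sub>R v n \<in> \<Theta>"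
    using w(1) unfolding contingent_cone_def by blast
  obtain \<rho> where \<rho>: "\<rho> > 0" and G_normal: "\<And>q. q \<in> G \<Longrightarrow> dist q (x, y) < \<rho> \<Longrightarrow>
      blinfun_apply (pair_functional f (- g)) (q - (x, y)) \<le> e' * norm (q - (x, y))"
    using eps_normals_lessD[OF _ e'(1), of "pair_functional f (- g)" "(x, y)" G] normal
    unfolding mirror_normal_def G_def by blast
  have "(\<lambda>n. t n *\<^sub>R v n) \<longlonglongrightarrow> 0 *\<^sub>R w" by (rule tendsto_scaleR[OF t(2) v])
  then have lim0: "(\<lambda>n. norm (t n *\<^sub>R v n)) \<longlonglongrightarrow> 0"
    unfolding scaleR_zero_left by (rule tendsto_norm_zero)
  define r where "r = min (\<delta> - norm (y - y0)) (\<rho> / (\<kappa> + 1))"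
  have "r > 0" using xy(3) \<rho> \<kappa> by (simp add: r_def)
  have "\<forall>\<^sub>F n in sequentially. norm (t n *\<^sub>R v n) < r"
    by (rule order_tendstoD(2)[OF lim0 \<open>r > 0\<close>])
  then have "\<forall>\<^sub>F n in sequentially. - blinfun_apply g (v n) \<le> c * norm (v n)"
  proof eventually_elim
    case (elim n)
    define yn where "yn = y + t n *\<^sub>R v n"
    define d where "d = norm (t n *\<^sub>R v n)"
    have d: "d < \<delta> - norm (y - y0)" "d < \<rho> / (\<kappa> + 1)" "d \<ge> 0" using elim by (auto simp: d_def r_def)
    have "norm (yn - y0) \<le> norm (y - y0) + d"
      using norm_triangle_ineq[of "y - y0" "t n *\<^sub>R v n"] by (simp add: yn_def d_def algebra_simps)
    then have "norm (yn - y0) < \<delta>" using d by linarith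
    then obtain xn where xn: "xn \<in> \<Omega>" "yn \<in> S xn" "norm (x - xn) \<le> \<kappa> * norm (y - yn)"
      using inv_lipschitz_on_ballD[OF lip, of x y yn] xy tv[of n] by (auto simp: gph_restr_iff yn_def)
    then have xn_x: "norm (xn - x) \<le> \<kappa> * d" by (simp add: yn_def d_def norm_minus_commute)
    have qG: "(xn, yn) \<in> G" using xn tv[of n] by (simp add: G_def gph_restr_iff yn_def)
    have q: "(xn, yn) - (x, y) = (xn - x, t n *\<^sub>R v n)" by (simp add: yn_def)
    have nq: "norm ((xn, yn) - (x, y)) \<le> (\<kappa> + 1) * d"
      unfolding q using norm_Pair_le[of "xn - x" "t n *\<^sub>R v n"] xn_x by (simp add: d_def algebra_simps)
    also have "\<dots> < \<rho>" using d(2) \<kappa> by (simp add: field_simps)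
    finally have "blinfun_apply (pair_functional f (- g)) ((xn, yn) - (x, y)) \<le> e' * norm ((xn, yn) - (x, y))"
      by (intro G_normal qG) (simp add: dist_norm)
    also have "\<dots> \<le> e' * ((\<kappa> + 1) * d)" using nq e'(2) by (rule mult_left_mono)
    finally have "blinfun_apply f (xn - x) - blinfun_apply g (t n *\<^sub>R v n) \<le> e' * ((\<kappa> + 1) * d)"
      unfolding q by (simp add: pair_functional_apply uminus_blinfun.rep_eq)
    moreover have "- blinfun_apply f (xn - x) \<le> norm f * (\<kappa> * d)"
      using norm_blinfun[of f "xn - x"] mult_left_mono[OF xn_x, of "norm f"] by simp
    ultimately have "- blinfun_apply g (t n *\<^sub>R v n) \<le> e' * ((\<kappa> + 1) * d) + norm f * (\<kappa> * d)" by linarith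
    also have "\<dots> = c * d" by (simp add: c_def algebra_simps)
    finally have "t n * (- blinfun_apply g (v n)) \<le> t n * (c * norm (v n))"
      using t(1)[of n] by (simp add: d_def blinfun.scaleR_right algebra_simps)
    then show ?case by (rule mult_left_le_imp_le) (rule t(1))
  qed
  then have "- blinfun_apply g w \<le> c * norm w"
    by (intro tendsto_le[OF sequentially_bot _ _ , where f = "\<lambda>n. c * norm (v n)" and g = "\<lambda>n. - blinfun_apply g (v n)"]
        tendsto_intros v) 
  then have "norm w * norm w \<le> c * norm w" unfolding gw by (simp add: power2_eq_square)
  then have "norm w \<le> c" using c by (cases "w = 0") auto
  then show "norm g \<le> \<kappa> * norm f + (\<kappa> + 1) * \<epsilon> + e" using e'(3) norm_g by (simp add: c_def)
qed

text \<open>Failure of the Lipschitz-like estimate produces mirror normals of the special form \<open>(0, g)\<close>.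
  Let \<open>(x', y')\<close> and \<open>y\<close> violate the estimate with constant \<open>2 / \<epsilon>\<close>. Ekeland's principle for
  \<open>(u, v) \<mapsto> norm (v - y)\<close> on the graph, started at \<open>(x', y')\<close>, gives a point \<open>(x1, y1)\<close>, and \<open>y1 \<noteq> y\<close>
  because of the violation. Smoothness of the norm at \<open>y1 - y\<close> turns minimality into
  \<open>\<epsilon>\<close>-normality of \<open>(0, - g)\<close> with \<open>g\<close> the norming functional of \<open>y1 - y\<close>, and \<open>- g\<close> is the duality
  image of the normalised vector \<open>y - y1\<close>, which is tangent to the convex set \<open>\<Theta>\<close> at \<open>y1\<close>.\<close>

lemma mirror_normal_of_not_inv_lipschitz:
  fixes S :: "'a::banach \<Rightarrow> 'b::banach set"
  assumes cl: "closed_around (gph (restr S \<Omega> \<Theta>)) (x0, y0)" and conv: "convex \<Theta>"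
    and luc: "locally_uniformly_convex TYPE('b \<Rightarrow>\<^sub>L real)"
    and fails: "\<not> (\<exists>\<delta>>0. \<exists>\<kappa>\<ge>0. inv_lipschitz_on_ball S \<Omega> \<Theta> x0 y0 \<delta> \<kappa>)"
    and \<epsilon>: "\<epsilon> > 0"
  shows "\<exists>x y g. (x, y) \<in> gph (restr S \<Omega> \<Theta>) \<and> dist (x, y) (x0, y0) < \<epsilon> \<and> norm g = 1 \<and>
    mirror_normal S \<Omega> \<Theta> \<epsilon> x y 0 g"
proof -
  define G where "G = gph (restr S \<Omega> \<Theta>)"
  obtain C where C: "(x0, y0) \<in> interior C" "closed (G \<inter> C)"
    using cl by (auto simp: closed_around_def G_def)
  obtain r0 where r0: "r0 > 0" "ball (x0, y0) r0 \<subseteq> interior C"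
    using C(1) open_contains_ball[of "interior C"] by auto
  define r where "r = min \<epsilon> r0"
  have r: "r > 0" "r \<le> \<epsilon>" "r \<le> r0" using \<epsilon> r0 by (auto simp: r_def)
  have in_C: "u \<in> interior C" if "dist u (x0, y0) < r" for u
    using that r(3) by (intro subsetD[OF r0(2)]) (simp add: dist_commute)
  \<comment> \<open>Ekeland's principle is used with slope \<open>\<epsilon> / 2 = 1 / \<kappa>\<close>, so it moves the starting point by at most
    \<open>\<kappa> * norm (y' - y) < 2 * \<kappa> * \<delta>\<close>; the choice of \<open>\<delta>\<close> keeps the result in the region where the
    graph is closed.\<close>
  define \<kappa> where "\<kappa> = 2 / \<epsilon>"
  define \<delta> where "\<delta> = r / (4 * (\<kappa> + 1))"
  have \<kappa>: "\<kappa> > 0" using \<epsilon> by (simp add: \<kappa>_def)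
  have \<delta>: "\<delta> > 0" "4 * ((\<kappa> + 1) * \<delta>) = r" using r \<kappa> by (auto simp: \<delta>_def field_simps)
  have "\<not> inv_lipschitz_on_ball S \<Omega> \<Theta> x0 y0 \<delta> \<kappa>" using fails \<delta> \<kappa> by (meson less_imp_le)
  then obtain x' y' y where x': "x' \<in> \<Omega>" and y': "y' \<in> \<Theta>" and y: "y \<in> \<Theta>" and S': "y' \<in> S x'"
    and near: "norm (x' - x0) < \<delta>" "norm (y' - y0) < \<delta>" "norm (y - y0) < \<delta>"
    and violation: "\<And>x. x \<in> \<Omega> \<Longrightarrow> y \<in> S x \<Longrightarrow> norm (x' - x) > \<kappa> * norm (y' - y)"
    unfolding inv_lipschitz_on_ball_def by force
  have y'y: "norm (y' - y) < 2 * \<delta>"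
    using near(2,3) norm_triangle_ineq4[of "y' - y0" "y - y0"] by simp
  have u0_near: "dist (x', y') (x0, y0) < 2 * \<delta>"
    using norm_Pair_le[of "x' - x0" "y' - y0"] near by (simp add: dist_norm)
  have "2 * \<delta> \<le> r" using \<delta> mult_pos_pos[OF \<kappa> \<delta>(1)] by (simp add: algebra_simps)
  then have "(x', y') \<in> G \<inter> C"
    using in_C[of "(x', y')"] u0_near x' y' S' interior_subset[of C] by (auto simp: G_def gph_restr_iff)
  moreover have "continuous_on (G \<inter> C) (\<lambda>u. norm (snd u - y))" by (intro continuous_intros)
  ultimately have "\<exists>u\<in>G \<inter> C. norm (snd u - y) + \<epsilon> / 2 * dist u (x', y') \<le> norm (snd (x', y') - y) \<and>
      (\<forall>w\<in>G \<inter> C. w \<noteq> u \<longrightarrow> norm (snd u - y) < norm (snd w - y) + \<epsilon> / 2 * dist w u)"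
    using \<epsilon> by (intro ekeland_variational_principle[where b = 0] C(2)) auto
  then obtain u where u: "u \<in> G \<inter> C"
    and u_le: "norm (snd u - y) + \<epsilon> / 2 * dist u (x', y') \<le> norm (y' - y)"
    and u_min: "\<And>w. w \<in> G \<inter> C \<Longrightarrow> w \<noteq> u \<Longrightarrow> norm (snd u - y) < norm (snd w - y) + \<epsilon> / 2 * dist w u"
    unfolding snd_conv by blast
  obtain x1 y1 where u_eq: "u = (x1, y1)" by (cases u)
  have u1: "x1 \<in> \<Omega>" "y1 \<in> \<Theta>" "y1 \<in> S x1" using u by (auto simp: u_eq G_def gph_restr_iff)
  have "\<epsilon> / 2 * dist u (x', y') \<le> norm (y' - y)" using u_le norm_ge_zero[of "snd u - y"] by linarith
  then have dist_u: "dist u (x', y') \<le> \<kappa> * norm (y' - y)"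
    using \<epsilon> by (simp add: \<kappa>_def field_simps)
  have "dist u (x0, y0) \<le> dist u (x', y') + dist (x', y') (x0, y0)" by (rule dist_triangle)
  also have "\<dots> < \<kappa> * (2 * \<delta>) + 2 * \<delta>"
    using dist_u u0_near mult_left_mono[of "norm (y' - y)" "2 * \<delta>" \<kappa>] y'y \<kappa> by linarith
  also have "\<dots> = r / 2" using \<delta>(2) by (simp add: algebra_simps)
  finally have u_near: "dist u (x0, y0) < r" using r(1) by simp
  have "y1 \<noteq> y"
  proof
    assume "y1 = y"
    then have "\<kappa> * norm (y' - y) < norm (x' - x1)" using violation u1 by blast
    moreover have "norm (x' - x1) \<le> dist u (x', y')"
      using dist_fst_le[of u "(x', y')"] by (simp add: u_eq dist_norm norm_minus_commute)
    ultimately show False using dist_u by linarith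
  qed
  then obtain g :: "'b \<Rightarrow>\<^sub>L real" where g: "norm g = 1" "blinfun_apply g (y1 - y) = norm (y1 - y)"
    using norming_functional[of "y1 - y"] by auto
  obtain d where d: "d > 0" and smooth: "\<And>h. norm h < d \<Longrightarrow>
      norm (y1 - y + h) \<le> norm (y1 - y) + blinfun_apply g h + \<epsilon> / 2 * norm h"
    using norm_frechet_upper_estimate[OF luc _ g, of "\<epsilon> / 2"] \<open>y1 \<noteq> y\<close> \<epsilon> by auto
  have "\<forall>\<^sub>F w in at u within G. w \<in> interior C \<and> dist w u < d \<and> w \<in> G \<and> w \<noteq> u"
  proof (intro eventually_conj)
    show "\<forall>\<^sub>F w in at u within G. w \<in> interior C"
      using in_C[OF u_near] topological_tendstoD[OF tendsto_ident_at open_interior] by blast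
    show "\<forall>\<^sub>F w in at u within G. dist w u < d" using d tendstoD[OF tendsto_ident_at] by blast
    show "\<forall>\<^sub>F w in at u within G. w \<in> G" "\<forall>\<^sub>F w in at u within G. w \<noteq> u"
      by (auto simp: eventually_at_filter)
  qed
  then have "\<forall>\<^sub>F w in at u within G. blinfun_apply (pair_functional 0 (- g)) (w - u) \<le> \<epsilon> * norm (w - u)"
  proof eventually_elim
    case (elim w)
    define h where "h = snd w - y1"
    have h: "norm h \<le> norm (w - u)"
      using dist_snd_le[of w u] by (simp add: h_def u_eq dist_norm)
    have "w \<in> G \<inter> C" using elim interior_subset by auto
    then have "norm (y1 - y) < norm (snd w - y) + \<epsilon> / 2 * norm (w - u)"
      using u_min[of w] elim by (simp add: u_eq dist_norm)
    also have "norm (snd w - y) \<le> norm (y1 - y) + blinfun_apply g h + \<epsilon> / 2 * norm h"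
      using smooth[of h] h elim by (simp add: h_def dist_norm)
    finally have "- blinfun_apply g h \<le> \<epsilon> / 2 * norm h + \<epsilon> / 2 * norm (w - u)" by linarith
    moreover have "\<epsilon> / 2 * norm h \<le> \<epsilon> / 2 * norm (w - u)" using h \<epsilon> by simp
    ultimately have "- blinfun_apply g h \<le> \<epsilon> * norm (w - u)" by linarith
    then show ?case by (simp add: pair_functional_apply uminus_blinfun.rep_eq h_def u_eq)
  qed
  then have "pair_functional 0 (- g) \<in> eps_normals \<epsilon> u G"
    using u \<epsilon> by (intro eps_normalsI) auto
  moreover have "- g \<in> (\<Union>w\<in>contingent_cone y1 \<Theta>. duality_map w)"
  proof (rule UN_I)
    show "(1 / norm (y1 - y)) *\<^sub>R (y - y1) \<in> contingent_cone y1 \<Theta>"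
      using conv u1(2) y \<open>y1 \<noteq> y\<close> by (intro convex_direction_in_contingent_cone) auto
    have "norm ((1 / norm (y1 - y)) *\<^sub>R (y - y1)) = 1"
      using \<open>y1 \<noteq> y\<close> by (simp add: norm_minus_commute[of y y1])
    moreover have "blinfun_apply (- g) ((1 / norm (y1 - y)) *\<^sub>R (y - y1)) = 1"
      using g(2) \<open>y1 \<noteq> y\<close>
      by (simp add: uminus_blinfun.rep_eq blinfun.scaleR_right blinfun.diff_right field_simps)
    ultimately show "- g \<in> duality_map ((1 / norm (y1 - y)) *\<^sub>R (y - y1))"
      using g(1) by (simp only: duality_map_def mem_Collect_eq norm_minus_cancel power_one)
  qed
  ultimately have "mirror_normal S \<Omega> \<Theta> \<epsilon> x1 y1 0 g"
    using zero_in_duality_image[OF u1(1)] by (simp add: mirror_normal_def u_eq G_def)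
  moreover have "(x1, y1) \<in> gph (restr S \<Omega> \<Theta>)" "dist (x1, y1) (x0, y0) < \<epsilon>"
    using u u_near r(2) by (auto simp: u_eq G_def)
  ultimately show ?thesis using g(1) by blast
qed

section \<open>The coderivative criterion\<close>

lemma zero_in_ker_mirror_coderivative:
  assumes "(x0, y0) \<in> gph (restr S \<Omega> \<Theta>)"
  shows "0 \<in> setmap_ker (mirror_coderivative S \<Omega> \<Theta> x0 y0)"
proof -
  have "mirror_normal S \<Omega> \<Theta> \<epsilon> x0 y0 0 0" if "\<epsilon> > 0" for \<epsilon>
    using that assms zero_in_duality_image[of x0 \<Omega>] zero_in_duality_image[of y0 \<Theta>]
    by (auto simp: mirror_normal_def gph_restr_iff pair_functional_apply intro!: eps_normalsI always_eventually)
  then show ?thesis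
    unfolding setmap_ker_def mirror_coderivative_def using assms
    by (intro CollectI exI[of _ "\<lambda>n. inverse (real (Suc n))"] exI[of _ "\<lambda>_. x0"] exI[of _ "\<lambda>_. y0"]
        exI[of _ "\<lambda>_. 0"] conjI) (use LIMSEQ_inverse_real_of_nat in \<open>auto simp: weak_star_lim_def\<close>)
qed

lemma mirror_normals_tendsto_zero:
  assumes lip: "inv_lipschitz_on_ball S \<Omega> \<Theta> x0 y0 \<delta> \<kappa>" and \<delta>: "\<delta> > 0" and \<kappa>: "\<kappa> \<ge> 0"
    and \<epsilon>: "\<And>k. \<epsilon> k > 0" "\<epsilon> \<longlonglongrightarrow> 0"
    and xy: "\<And>k. (x k, y k) \<in> gph (restr S \<Omega> \<Theta>)" "(\<lambda>k. (x k, y k)) \<longlonglongrightarrow> (x0, y0)"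
    and f: "f \<longlonglongrightarrow> 0" and normal: "\<And>k. mirror_normal S \<Omega> \<Theta> (\<epsilon> k) (x k) (y k) (f k) (g k)"
  shows "(\<lambda>k. norm (g k)) \<longlonglongrightarrow> 0"
proof (rule tendsto_sandwich[OF _ _ tendsto_const])
  show "\<forall>\<^sub>F k in sequentially. 0 \<le> norm (g k)" by simp
  have "x \<longlonglongrightarrow> x0" "y \<longlonglongrightarrow> y0" using tendsto_fst[OF xy(2)] tendsto_snd[OF xy(2)] by auto
  then have "\<forall>\<^sub>F k in sequentially. dist (x k) x0 < \<delta>" "\<forall>\<^sub>F k in sequentially. dist (y k) y0 < \<delta>"
    using \<delta> by (auto dest: tendstoD)
  then show "\<forall>\<^sub>F k in sequentially. norm (g k) \<le> \<kappa> * norm (f k) + (\<kappa> + 1) * \<epsilon> k"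
  proof eventually_elim
    case (elim k)
    then show ?case
      by (intro mirror_normal_norm_bound[OF lip \<kappa> less_imp_le[OF \<epsilon>(1)] xy(1) _ _ normal])
        (auto simp: dist_norm)
  qed
  have "(\<lambda>k. \<kappa> * norm (f k) + (\<kappa> + 1) * \<epsilon> k) \<longlonglongrightarrow> \<kappa> * 0 + (\<kappa> + 1) * 0"
    by (intro tendsto_intros \<epsilon>(2) tendsto_norm_zero f)
  then show "(\<lambda>k. \<kappa> * norm (f k) + (\<kappa> + 1) * \<epsilon> k) \<longlonglongrightarrow> 0" by simp
qed

lemma inv_lipschitz_imp_mirror_criterion:
  assumes lip: "inv_lipschitz_on_ball S \<Omega> \<Theta> x0 y0 \<delta> \<kappa>" and \<delta>: "\<delta> > 0" and \<kappa>: "\<kappa> \<ge> 0"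
    and x0y0: "(x0, y0) \<in> gph (restr S \<Omega> \<Theta>)"
  shows "mirror_PSNC S \<Omega> \<Theta> x0 y0 \<and> setmap_ker (mirror_coderivative S \<Omega> \<Theta> x0 y0) = {0}"
proof
  show "mirror_PSNC S \<Omega> \<Theta> x0 y0"
    unfolding mirror_PSNC_def using mirror_normals_tendsto_zero[OF lip \<delta> \<kappa>] by blast
  have "g0 = 0" if "0 \<in> mirror_coderivative S \<Omega> \<Theta> x0 y0 g0" for g0
  proof -
    obtain \<epsilon> x y f g where "\<And>k. \<epsilon> k > (0::real)" "\<epsilon> \<longlonglongrightarrow> 0"
      "\<And>k. (x k, y k) \<in> gph (restr S \<Omega> \<Theta>)" "(\<lambda>k. (x k, y k)) \<longlonglongrightarrow> (x0, y0)"
      and g: "weak_star_lim g g0"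
      and "f \<longlonglongrightarrow> 0" "\<And>k. mirror_normal S \<Omega> \<Theta> (\<epsilon> k) (x k) (y k) (f k) (g k)"
      using \<open>0 \<in> mirror_coderivative S \<Omega> \<Theta> x0 y0 g0\<close> unfolding mirror_coderivative_def by blast
    then have "(\<lambda>k. norm (g k)) \<longlonglongrightarrow> 0" by (intro mirror_normals_tendsto_zero[OF lip \<delta> \<kappa>])
    then have "g \<longlonglongrightarrow> 0" by (rule tendsto_norm_zero_cancel)
    then have "(\<lambda>k. blinfun_apply (g k) v) \<longlonglongrightarrow> blinfun_apply 0 v" for v
      by (intro tendsto_intros)
    then have "blinfun_apply g0 v = blinfun_apply 0 v" for v
      using g unfolding weak_star_lim_def by (blast intro: LIMSEQ_unique)
    then show ?thesis by (intro blinfun_eqI)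
  qed
  then show "setmap_ker (mirror_coderivative S \<Omega> \<Theta> x0 y0) = {0}"
    using zero_in_ker_mirror_coderivative[OF x0y0] by (auto simp: setmap_ker_def)
qed

lemma mirror_criterion_imp_inv_lipschitz:
  fixes S :: "'a::banach \<Rightarrow> 'b::banach set"
  assumes cl: "closed_around (gph (restr S \<Omega> \<Theta>)) (x0, y0)" and conv: "convex \<Theta>"
    and Y: "reflexive_luc TYPE('b)"
    and psnc: "mirror_PSNC S \<Omega> \<Theta> x0 y0"
    and ker: "setmap_ker (mirror_coderivative S \<Omega> \<Theta> x0 y0) = {0}"
  shows "\<exists>\<delta>>0. \<exists>\<kappa>\<ge>0. inv_lipschitz_on_ball S \<Omega> \<Theta> x0 y0 \<delta> \<kappa>"
proof (rule ccontr)
  assume fails: "\<not> ?thesis"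
  define \<epsilon> where "\<epsilon> n = inverse (real (Suc (Suc n)))" for n
  have \<epsilon>: "0 < \<epsilon> n" "\<epsilon> n < 1" for n by (auto simp: \<epsilon>_def field_simps)
  have \<epsilon>_lim: "\<epsilon> \<longlonglongrightarrow> 0" unfolding \<epsilon>_def using LIMSEQ_Suc[OF LIMSEQ_inverse_real_of_nat] by simp
  have "\<forall>n. \<exists>x y g. (x, y) \<in> gph (restr S \<Omega> \<Theta>) \<and> dist (x, y) (x0, y0) < \<epsilon> n \<and> norm g = 1 \<and>
      mirror_normal S \<Omega> \<Theta> (\<epsilon> n) x y 0 g"
    using mirror_normal_of_not_inv_lipschitz[OF cl conv _ fails \<epsilon>(1)] Y
    by (simp add: reflexive_luc_def)
  then obtain x y g where xy: "\<And>n. (x n, y n) \<in> gph (restr S \<Omega> \<Theta>)"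
    and xy_near: "\<And>n. dist (x n, y n) (x0, y0) < \<epsilon> n" and g: "\<And>n. norm (g n) = 1"
    and normal: "\<And>n. mirror_normal S \<Omega> \<Theta> (\<epsilon> n) (x n) (y n) 0 (g n)"
    by metis
  have xy_lim: "(\<lambda>n. (x n, y n)) \<longlonglongrightarrow> (x0, y0)"
    by (rule metric_tendsto_imp_tendsto[OF \<epsilon>_lim])
      (use xy_near \<epsilon>(1) in \<open>auto simp: less_imp_le\<close>)
  obtain g0 r where r: "strict_mono (r :: nat \<Rightarrow> nat)" and g0: "weak_star_lim (g \<circ> r) g0"
    using weak_star_sequentially_compact[of g 1] Y g by (auto simp: reflexive_luc_def)
  have sub: "(\<epsilon> \<circ> r) \<longlonglongrightarrow> 0" "(\<lambda>k. ((x \<circ> r) k, (y \<circ> r) k)) \<longlonglongrightarrow> (x0, y0)"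
    using LIMSEQ_subseq_LIMSEQ[OF \<epsilon>_lim r] LIMSEQ_subseq_LIMSEQ[OF xy_lim r] by (auto simp: o_def)
  have "0 \<in> mirror_coderivative S \<Omega> \<Theta> x0 y0 g0"
    unfolding mirror_coderivative_def
    by (intro CollectI exI[of _ "\<epsilon> \<circ> r"] exI[of _ "x \<circ> r"] exI[of _ "y \<circ> r"] exI[of _ "\<lambda>_. 0"]
        exI[of _ "g \<circ> r"] conjI sub g0) (auto simp: \<epsilon> xy normal)
  then have "g0 = 0" using ker by (auto simp: setmap_ker_def)
  have "(\<forall>k. 0 < (\<epsilon> \<circ> r) k \<and> (\<epsilon> \<circ> r) k < 1) \<and> (\<epsilon> \<circ> r) \<longlonglongrightarrow> 0 \<and>
      (\<forall>k. ((x \<circ> r) k, (y \<circ> r) k) \<in> gph (restr S \<Omega> \<Theta>)) \<and>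
      (\<lambda>k. ((x \<circ> r) k, (y \<circ> r) k)) \<longlonglongrightarrow> (x0, y0) \<and>
      (\<lambda>_. 0 :: 'a \<Rightarrow>\<^sub>L real) \<longlonglongrightarrow> 0 \<and> weak_star_lim (g \<circ> r) 0 \<and>
      (\<forall>k. mirror_normal S \<Omega> \<Theta> ((\<epsilon> \<circ> r) k) ((x \<circ> r) k) ((y \<circ> r) k) 0 ((g \<circ> r) k))"
    using sub g0 \<open>g0 = 0\<close> by (auto simp: \<epsilon> xy normal)
  then have "(\<lambda>k. norm ((g \<circ> r) k)) \<longlonglongrightarrow> 0"
    using psnc unfolding mirror_PSNC_def by blast
  then show False using g by (simp add: LIMSEQ_const_iff)
qed

theorem theorem3p11:
  fixes S :: "'a::banach \<Rightarrow> 'b::banach set"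
    and \<Omega> :: "'a set" and \<Theta> :: "'b set"
    and xbar :: 'a and ybar :: 'b
  assumes "closed \<Omega>" and "closed \<Theta>"
    and "(xbar, ybar) \<in> gph (restr S \<Omega> \<Theta>)"
    and "closed_around (gph (restr S \<Omega> \<Theta>)) (xbar, ybar)"
  shows "(lipschitz_like_rel (setmap_inv S) \<Theta> \<Omega> ybar xbar \<longleftrightarrow> metrically_regular_rel S \<Omega> \<Theta> xbar ybar) \<and>
    (metrically_regular_rel S \<Omega> \<Theta> xbar ybar \<longleftrightarrow> linearly_open_rel S \<Omega> \<Theta> xbar ybar) \<and>
    (reflexive_luc TYPE('a) \<and> reflexive_luc TYPE('b) \<and> convex \<Omega> \<and> convex \<Theta> \<longrightarrow>
      (lipschitz_like_rel (setmap_inv S) \<Theta> \<Omega> ybar xbar \<longleftrightarrow>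
        mirror_PSNC S \<Omega> \<Theta> xbar ybar \<and>
        setmap_ker (mirror_coderivative S \<Omega> \<Theta> xbar ybar) = {0}))"
proof -
  let ?L = "\<exists>\<delta>>0. \<exists>\<kappa>\<ge>0. inv_lipschitz_on_ball S \<Omega> \<Theta> xbar ybar \<delta> \<kappa>"
  have a: "lipschitz_like_rel (setmap_inv S) \<Theta> \<Omega> ybar xbar \<longleftrightarrow> ?L"
    by (rule lipschitz_like_inv_iff[OF assms(4)])
  have ab: "?L \<Longrightarrow> metrically_regular_rel S \<Omega> \<Theta> xbar ybar"
    using assms(3) by (auto simp: gph_restr_iff intro: inv_lipschitz_imp_metrically_regular)
  have bc: "metrically_regular_rel S \<Omega> \<Theta> xbar ybar \<Longrightarrow> linearly_open_rel S \<Omega> \<Theta> xbar ybar"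
    by (rule metrically_regular_imp_linearly_open)
  have ca: "linearly_open_rel S \<Omega> \<Theta> xbar ybar \<Longrightarrow> ?L"
    by (rule linearly_open_imp_inv_lipschitz)
  have ad: "?L \<Longrightarrow> mirror_PSNC S \<Omega> \<Theta> xbar ybar \<and>
      setmap_ker (mirror_coderivative S \<Omega> \<Theta> xbar ybar) = {0}"
    using inv_lipschitz_imp_mirror_criterion[OF _ _ _ assms(3)] by blast
  have da: "reflexive_luc TYPE('b) \<Longrightarrow> convex \<Theta> \<Longrightarrow> mirror_PSNC S \<Omega> \<Theta> xbar ybar \<Longrightarrow>
      setmap_ker (mirror_coderivative S \<Omega> \<Theta> xbar ybar) = {0} \<Longrightarrow> ?L"
    using mirror_criterion_imp_inv_lipschitz[OF assms(4)] by blast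
  from ab bc ca ad da show ?thesis unfolding a by meson
qed

end
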